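(* Let $G$ be a graph of order at least three. If for every $S\subseteq V(G)$, $$\omega(G\setminus S)\le \min \Big\{\frac{2}{7}|S|,\ \frac{1}{2}|S|-\frac{3}{2}\, iso(G\setminus S)\Big\}+1,$$ then $G$ admits a connected $\{2,4\}$-factor.
   Context: Graphs are finite, loopless, and may have multiple edges. $\omega(H)$ denotes the number of components of $H$ and $iso(H)$ the number of isolated vertices of $H$; $G\setminus S$ is obtained by deleting the vertices in $S$. A $\{2,4\}$-factor is a spanning subgraph in which every vertex has degree $2$ or $4$. *)

theory Defs
  imports Complex_Main
begin

record ('v, 'e) mgraph =
  verts :: "'v set"
  edges :: "'e set"
  ends :: "'e \<Rightarrow> 'v set"

text \<open>Edges have an identity of their own, so parallel edges are distinct edges with the same
  pair of ends. Exactly two ends means that there are no loops. Values of \<open>ends\<close> outside the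
  edge set are irrelevant.\<close>

locale multigraph =
  fixes G :: "('v, 'e) mgraph" (structure)
  assumes finite_verts: "finite (verts G)"
    and finite_edges: "finite (edges G)"
    and ends_subset: "e \<in> edges G \<Longrightarrow> ends G e \<subseteq> verts G"
    and card_ends: "e \<in> edges G \<Longrightarrow> card (ends G e) = 2"

definition degree :: "('v, 'e) mgraph \<Rightarrow> 'v \<Rightarrow> nat" where
  "degree G v = card {e \<in> edges G. v \<in> ends G e}"

definition adj_rel :: "('v, 'e) mgraph \<Rightarrow> ('v \<times> 'v) set" where
  "adj_rel G = {(u, v). \<exists>e \<in> edges G. ends G e = {u, v}}"

definition joined_rel :: "('v, 'e) mgraph \<Rightarrow> ('v \<times> 'v) set" where
  "joined_rel G = {(u, v). u \<in> verts G \<and> v \<in> verts G \<and> (u, v) \<in> (adj_rel G)\<^sup>*}"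

text \<open>Components are represented by their vertex sets; the graph without vertices has none,
  and so is not connected.\<close>

definition components :: "('v, 'e) mgraph \<Rightarrow> 'v set set" where
  "components G = verts G // joined_rel G"

definition num_components :: "('v, 'e) mgraph \<Rightarrow> nat" where
  "num_components G = card (components G)"

definition connected_graph :: "('v, 'e) mgraph \<Rightarrow> bool" where
  "connected_graph G \<longleftrightarrow> num_components G = 1"

definition num_isolated :: "('v, 'e) mgraph \<Rightarrow> nat" where
  "num_isolated G = card {v \<in> verts G. degree G v = 0}"

definition delete_verts :: "('v, 'e) mgraph \<Rightarrow> 'v set \<Rightarrow> ('v, 'e) mgraph" where
  "delete_verts G S =
     \<lparr>verts = verts G - S, edges = {e \<in> edges G. ends G e \<inter> S = {}}, ends = ends G\<rparr>"

definition spanning_subgraph :: "('v, 'e) mgraph \<Rightarrow> ('v, 'e) mgraph \<Rightarrow> bool" where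
  "spanning_subgraph H G \<longleftrightarrow>
     verts H = verts G \<and> edges H \<subseteq> edges G \<and> (\<forall>e \<in> edges H. ends H e = ends G e)"

definition two_four_factor :: "('v, 'e) mgraph \<Rightarrow> ('v, 'e) mgraph \<Rightarrow> bool" where
  "two_four_factor F G \<longleftrightarrow>
     spanning_subgraph F G \<and> (\<forall>v \<in> verts F. degree F v \<in> {2, 4})"

end

theory Submission
  imports Defs "HOL-Library.Disjoint_Sets"
begin

text \<open>It suffices to find two edge-disjoint connected spanning subgraphs whose union has maximum
  degree at most \<open>5\<close>: one of them together with a suitable parity join inside the other is
  connected and has positive even degrees. Any set \<open>H\<close> of \<open>2 |V| - 2\<close> edges
  with at most \<open>2 |X| - 2\<close> edges inside each nonempty \<open>X\<close> splits into two connected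
  spanning subgraphs (by induction, removing a vertex of degree \<open>2\<close> or \<open>3\<close>). Choose \<open>H\<close> with the
  least total excess of degrees over \<open>5\<close>. If the excess is positive, an exchange argument
  as in Win's theorem on spanning trees of bounded degree gives a set \<open>S\<close> of vertices of
  degree at least \<open>5\<close> such that every edge of \<open>G - S\<close> outside \<open>H\<close>
  lies inside a set that avoids \<open>S\<close> and attains the bound. Then the vertices outside
  \<open>S\<close> have a partition \<open>P\<close> for which twice the number of parts minus the
  number of edges between parts exceeds \<open>|S| + 2\<close>. Deleting further vertices turns this
  into a violation of the inequality \<open>2 \<omega>(G - S) + 3 iso(G - S) \<le> |S| +
  2\<close>.\<close>

section \<open>Sparse edge sets and tight vertex sets\<close>

definition induced :: "('e \<Rightarrow> 'v set) \<Rightarrow> 'e set \<Rightarrow> 'v set \<Rightarrow> 'e set" where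
  "induced en H X = {e \<in> H. en e \<subseteq> X}"

definition deg :: "('e \<Rightarrow> 'v set) \<Rightarrow> 'e set \<Rightarrow> 'v \<Rightarrow> nat" where
  "deg en H v = card {e \<in> H. v \<in> en e}"

text \<open>For edges inside \<open>V\<close> these are the edge sets that split into two forests
  (Nash-Williams), that is, the independent sets of the union of two graphic matroids. The 2 stands
  on the left because natural subtraction truncates.\<close>

definition sparse :: "('e \<Rightarrow> 'v set) \<Rightarrow> 'v set \<Rightarrow> 'e set \<Rightarrow> bool" where
  "sparse en V H \<longleftrightarrow> (\<forall>X \<subseteq> V. X \<noteq> {} \<longrightarrow> card (induced en H X) + 2 \<le> 2 * card X)"

definition tight :: "('e \<Rightarrow> 'v set) \<Rightarrow> 'e set \<Rightarrow> 'v set \<Rightarrow> bool" where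
  "tight en H X \<longleftrightarrow> X \<noteq> {} \<and> card (induced en H X) + 2 = 2 * card X"

text \<open>\<open>P\<close> is meant to partition only the vertices left after a deletion, so edges
  with an end outside its union must not count.\<close>

definition cross :: "('e \<Rightarrow> 'v set) \<Rightarrow> 'e set \<Rightarrow> 'v set set \<Rightarrow> 'e set" where
  "cross en H P = {e \<in> H. en e \<subseteq> \<Union>P \<and> (\<forall>B \<in> P. \<not> en e \<subseteq> B)}"

definition adjacent :: "('e \<Rightarrow> 'v set) \<Rightarrow> 'e set \<Rightarrow> ('v \<times> 'v) set" where
  "adjacent en C = {(u, v). \<exists>e \<in> C. en e = {u, v}}"

definition connects :: "('e \<Rightarrow> 'v set) \<Rightarrow> 'v set \<Rightarrow> 'e set \<Rightarrow> bool" where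
  "connects en V C \<longleftrightarrow> (\<forall>u \<in> V. \<forall>v \<in> V. (u, v) \<in> (adjacent en C)\<^sup>*)"

lemma sparseD:
  "sparse en V H \<Longrightarrow> X \<subseteq> V \<Longrightarrow> X \<noteq> {} \<Longrightarrow> card (induced en H X) + 2 \<le> 2 * card X"
  by (simp add: sparse_def)

lemma finite_induced [simp]: "finite H \<Longrightarrow> finite (induced en H X)"
  by (simp add: induced_def)

text \<open>The edges inside \<open>X\<close> are those inside \<open>B\<close> and the others, and
  the others are common to both sets. This carries counts, and so tightness, to larger sets after a
  rearrangement inside \<open>B\<close>.\<close>

lemma card_agree:
  assumes "finite H" "finite K" "H - induced en H B = K - induced en K B"
    "card (induced en H B) = card (induced en K B)" "B \<subseteq> X"
  shows "card (induced en H X) = card (induced en K X)"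
proof -
  have split: "card (induced en L X) = card (induced en L B) + card (induced en (L - induced en L B) X)"
    if "finite L" for L
  proof -
    have "induced en L X = induced en L B \<union> induced en (L - induced en L B) X"
      using assms(5) by (auto simp: induced_def)
    moreover have "induced en L B \<inter> induced en (L - induced en L B) X = {}"
      by (auto simp: induced_def)
    ultimately show ?thesis using that by (metis card_Un_disjoint finite_Diff finite_induced)
  qed
  show ?thesis using split[OF assms(1)] split[OF assms(2)] assms(3,4) by simp
qed

section \<open>Uncrossing and exchange in tight sets\<close>

locale edge_system =
  fixes V :: "'v set" and E :: "'e set" and en :: "'e \<Rightarrow> 'v set"
  assumes finite_V: "finite V"
    and finite_E: "finite E"
    and en_subset: "e \<in> E \<Longrightarrow> en e \<subseteq> V"
    and card_en: "e \<in> E \<Longrightarrow> card (en e) = 2"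
begin

lemma sub_system: "H \<subseteq> E \<Longrightarrow> edge_system V H en"
  using finite_V finite_E en_subset card_en by unfold_locales (auto intro: finite_subset)

lemma finite_sub: "H \<subseteq> E \<Longrightarrow> finite H"
  using finite_E finite_subset by blast

lemma other_end:
  assumes "e \<in> E" "v \<in> en e"
  obtains a where "a \<in> V" "a \<noteq> v" "en e = {v, a}"
proof -
  obtain x y where "en e = {x, y}" "x \<noteq> y"
    using card_en[OF assms(1)] by (auto simp: card_2_iff)
  then show ?thesis using that[of x] that[of y] assms(2) en_subset[OF assms(1)] by auto
qed

lemma induced_singleton: "H \<subseteq> E \<Longrightarrow> induced en H {v} = {}"
  using card_en by (force simp: induced_def subset_singleton_iff)

lemma tight_singleton: "H \<subseteq> E \<Longrightarrow> tight en H {v}"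
  by (simp add: tight_def induced_singleton)

lemma induced_V: "H \<subseteq> E \<Longrightarrow> induced en H V = H"
  using en_subset by (auto simp: induced_def)

text \<open>Uncrossing: the number of induced edges is supermodular while twice the number of
  vertices is modular, so equality for \<open>X\<close> and \<open>Y\<close> forces equality for
  both the intersection and the union. Disjoint sets are excluded because sparsity says nothing
  about the empty set.\<close>

lemma tight_Int_Un:
  assumes "H \<subseteq> E" "sparse en V H" "X \<subseteq> V" "Y \<subseteq> V" "tight en H X" "tight en H Y" "X \<inter> Y \<noteq> {}"
  shows "tight en H (X \<inter> Y)" "tight en H (X \<union> Y)"
proof -
  have fin: "finite X" "finite Y" "finite H" using assms finite_V finite_E finite_subset by blast+
  have "card (induced en H X) + card (induced en H Y)
      = card (induced en H X \<union> induced en H Y) + card (induced en H X \<inter> induced en H Y)"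
    using fin by (intro card_Un_Int) auto
  also have "induced en H X \<inter> induced en H Y = induced en H (X \<inter> Y)"
    by (auto simp: induced_def)
  also have "card (induced en H X \<union> induced en H Y) \<le> card (induced en H (X \<union> Y))"
    using fin by (intro card_mono) (auto simp: induced_def)
  finally have "card (induced en H X) + card (induced en H Y)
      \<le> card (induced en H (X \<union> Y)) + card (induced en H (X \<inter> Y))" by simp
  moreover have "card X + card Y = card (X \<union> Y) + card (X \<inter> Y)"
    using fin by (intro card_Un_Int)
  moreover have "card (induced en H (X \<union> Y)) + 2 \<le> 2 * card (X \<union> Y)"
    using assms by (intro sparseD) auto
  moreover have "card (induced en H (X \<inter> Y)) + 2 \<le> 2 * card (X \<inter> Y)"
    using assms by (intro sparseD) auto
  ultimately show "tight en H (X \<inter> Y)" "tight en H (X \<union> Y)"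
    using assms(5-7) by (auto simp: tight_def)
qed

lemma sparse_insert:
  assumes "finite H" "sparse en V H" "\<And>X. X \<subseteq> V \<Longrightarrow> tight en H X \<Longrightarrow> \<not> en e \<subseteq> X"
  shows "sparse en V (insert e H)"
  unfolding sparse_def
proof (intro allI impI)
  fix X assume X: "X \<subseteq> V" "X \<noteq> {}"
  have le: "card (induced en H X) + 2 \<le> 2 * card X" using assms(2) X by (auto simp: sparse_def)
  show "card (induced en (insert e H) X) + 2 \<le> 2 * card X"
  proof (cases "en e \<subseteq> X")
    case True
    then have "card (induced en H X) + 2 \<noteq> 2 * card X" using assms(3) X by (auto simp: tight_def)
    moreover have "induced en (insert e H) X \<subseteq> insert e (induced en H X)" by (auto simp: induced_def)
    then have "card (induced en (insert e H) X) \<le> card (insert e (induced en H X))"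
      using assms(1) by (intro card_mono) auto
    moreover have "card (insert e (induced en H X)) \<le> Suc (card (induced en H X))"
      using assms(1) by (simp add: card_insert_if)
    ultimately show ?thesis using le by linarith
  next
    case False
    then have "induced en (insert e H) X = induced en H X" by (auto simp: induced_def)
    then show ?thesis using le by simp
  qed
qed

lemma sparse_mono:
  assumes "finite H" "sparse en V H" "K \<subseteq> H"
  shows "sparse en V K"
  unfolding sparse_def
proof (intro allI impI)
  fix X assume X: "X \<subseteq> V" "X \<noteq> {}"
  have "card (induced en K X) \<le> card (induced en H X)"
    using assms by (intro card_mono) (auto simp: induced_def)
  then show "card (induced en K X) + 2 \<le> 2 * card X"
    using sparseD[OF assms(2) X] by linarith
qed

text \<open>A tight set \<open>Y\<close> that still blocks \<open>e\<close> after \<open>f\<close>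
  is gone would be tight in \<open>H\<close> as well and would miss \<open>f\<close>; then
  \<open>X \<inter> Y\<close> would be a smaller tight set around \<open>e\<close>. For
  \<open>e\<close> outside \<open>H\<close>, the edges inside \<open>X\<close> together with
  \<open>e\<close> form the fundamental circuit of \<open>e\<close>.\<close>

lemma sparse_swap:
  assumes "H \<subseteq> E" "sparse en V H" "e \<in> E"
    and X: "X \<subseteq> V" "tight en H X" "en e \<subseteq> X"
    and min: "\<And>Y. Y \<subseteq> X \<Longrightarrow> tight en H Y \<Longrightarrow> en e \<subseteq> Y \<Longrightarrow> Y = X"
    and f: "f \<in> induced en H X"
  shows "sparse en V (insert e (H - {f}))"
proof (rule sparse_insert)
  have fin: "finite H" using assms(1) finite_sub by blast
  then show "finite (H - {f})" by simp
  show "sparse en V (H - {f})" using sparse_mono[OF fin assms(2)] by blast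
  fix Y assume Y: "Y \<subseteq> V" "tight en (H - {f}) Y"
  show "\<not> en e \<subseteq> Y"
  proof
    assume eY: "en e \<subseteq> Y"
    have "Y \<noteq> {}" using Y by (auto simp: tight_def)
    then have le: "card (induced en H Y) + 2 \<le> 2 * card Y" using assms(2) Y(1) by (auto simp: sparse_def)
    have sub: "induced en (H - {f}) Y \<subseteq> induced en H Y" by (auto simp: induced_def)
    have eq: "card (induced en (H - {f}) Y) + 2 = 2 * card Y" using Y(2) by (simp add: tight_def)
    have "induced en (H - {f}) Y = induced en H Y"
      using le eq sub fin by (intro card_subset_eq) (auto dest: card_mono[OF finite_induced[OF fin, of en Y]])
    then have "tight en H Y" and fY: "\<not> en f \<subseteq> Y"
      using Y(2) f by (auto simp: tight_def induced_def)
    moreover have "en e \<subseteq> X \<inter> Y" "en e \<noteq> {}" using X(3) eY card_en[OF assms(3)] by auto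
    then have "X \<inter> Y \<noteq> {}" by blast
    ultimately have "tight en H (X \<inter> Y)"
      using tight_Int_Un(1)[OF assms(1,2) X(1) Y(1) X(2)] by blast
    then have "X \<inter> Y = X" using min[of "X \<inter> Y"] X(3) eY by auto
    then show False using f fY by (auto simp: induced_def)
  qed
qed

text \<open>Otherwise removing \<open>w\<close> would lose no edge while the bound drops by
  2.\<close>

lemma tight_incident:
  assumes "H \<subseteq> E" "sparse en V H" "X \<subseteq> V" "tight en H X" "w \<in> X" "x \<in> X" "x \<noteq> w"
  obtains f where "f \<in> induced en H X" "w \<in> en f"
proof (rule ccontr)
  assume "\<not> thesis"
  then have "\<forall>f \<in> induced en H X. w \<notin> en f" using that by blast
  then have "induced en H (X - {w}) = induced en H X" by (auto simp: induced_def)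
  moreover have "X - {w} \<subseteq> V" "X - {w} \<noteq> {}" using assms by auto
  ultimately have "card (induced en H X) + 2 \<le> 2 * card (X - {w})"
    using sparseD[OF assms(2)] by metis
  moreover have "card X = Suc (card (X - {w}))"
    using assms(3,5) finite_V by (metis card_Suc_Diff1 finite_subset)
  ultimately show False using assms(4) by (auto simp: tight_def)
qed

text \<open>Since \<open>B\<close> is tight, supermodularity leaves at most 2|X - B| edges of
  \<open>H\<close> that lie inside \<open>X\<close> but not inside \<open>X \<inter> B\<close>. If
  \<open>X\<close> meets \<open>B\<close>, the set \<open>K\<close> adds at most 2|X \<inter> B| - 2
  more.\<close>

lemma sparse_replace:
  assumes HE: "H \<subseteq> E" and KE: "K \<subseteq> E" and H: "sparse en V H" and K: "sparse en V K"
    and B: "B \<subseteq> V" "tight en H B"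
  shows "sparse en V ((H - induced en H B) \<union> induced en K B)"
  unfolding sparse_def
proof (intro allI impI)
  let ?L = "(H - induced en H B) \<union> induced en K B"
  fix X assume X: "X \<subseteq> V" "X \<noteq> {}"
  have fin: "finite X" "finite B" "finite H" "finite K"
    using X(1) B(1) HE KE finite_V finite_E finite_subset by blast+
  have "induced en ?L X = (induced en H X - induced en H (X \<inter> B)) \<union> induced en K (X \<inter> B)"
    by (auto simp: induced_def)
  then have L: "card (induced en ?L X)
      \<le> card (induced en H X - induced en H (X \<inter> B)) + card (induced en K (X \<inter> B))"
    by (metis card_Un_le)
  have sub: "card (induced en H X - induced en H (X \<inter> B))
      = card (induced en H X) - card (induced en H (X \<inter> B))"
    using fin by (intro card_Diff_subset) (auto simp: induced_def)
  have HX: "card (induced en H X) + 2 \<le> 2 * card X" using H X by (auto simp: sparse_def)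
  show "card (induced en ?L X) + 2 \<le> 2 * card X"
  proof (cases "X \<inter> B = {}")
    case True
    have "induced en K {} = {}" using KE card_en by (force simp: induced_def)
    then show ?thesis using L sub HX True by simp
  next
    case False
    have "card (induced en H X) + card (induced en H B)
      = card (induced en H X \<union> induced en H B) + card (induced en H X \<inter> induced en H B)"
      using fin by (intro card_Un_Int) auto
    also have "induced en H X \<inter> induced en H B = induced en H (X \<inter> B)"
      by (auto simp: induced_def)
    also have "card (induced en H X \<union> induced en H B) \<le> card (induced en H (X \<union> B))"
      using fin by (intro card_mono) (auto simp: induced_def)
    finally have "card (induced en H X) + card (induced en H B)
      \<le> card (induced en H (X \<union> B)) + card (induced en H (X \<inter> B))" by simp
    moreover have "card X + card B = card (X \<union> B) + card (X \<inter> B)"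
      using fin by (intro card_Un_Int)
    moreover have "card (induced en H (X \<union> B)) + 2 \<le> 2 * card (X \<union> B)"
      using H X B(1) by (intro sparseD) auto
    moreover have "card (induced en K (X \<inter> B)) + 2 \<le> 2 * card (X \<inter> B)"
      using K X False by (intro sparseD) auto
    moreover have "card (induced en H B) + 2 = 2 * card B" using B(2) by (simp add: tight_def)
    moreover have "card (induced en H (X \<inter> B)) \<le> card (induced en H X)"
      using fin by (intro card_mono) (auto simp: induced_def)
    ultimately show ?thesis using L sub HX by linarith
  qed
qed

text \<open>An edge with 0, 1 or 2 ends in \<open>S\<close> contributes 1, 1 or 2 to either
  side.\<close>

lemma sum_deg:
  assumes "H \<subseteq> E" "S \<subseteq> V"
  shows "card (induced en H (V - S)) + (\<Sum>v\<in>S. deg en H v) = card H + card (induced en H S)"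
proof -
  have fin: "finite S" "finite H" using assms finite_V finite_E finite_subset by blast+
  have "(\<Sum>v\<in>S. deg en H v) = (\<Sum>e\<in>H. card (en e \<inter> S))"
    unfolding deg_def by (rule sum_multicount_gen[OF fin]) (auto intro!: arg_cong[where f = card])
  moreover have "card (induced en H X) = (\<Sum>e\<in>H. if en e \<subseteq> X then 1 else 0)" for X
    using fin by (simp add: induced_def sum.If_cases Int_def)
  moreover have "(if en e \<subseteq> V - S then 1 else 0) + card (en e \<inter> S) = 1 + (if en e \<subseteq> S then 1 else 0)"
    if "e \<in> H" for e
  proof -
    have "card (en e) = 2" using card_en that assms(1) by blast
    then obtain x y where xy: "en e = {x, y}" "x \<noteq> y" unfolding card_2_iff by blast
    moreover have "{x, y} \<subseteq> V" using xy en_subset that assms(1) by blast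
    ultimately show ?thesis by (cases "x \<in> S"; cases "y \<in> S") (auto simp: Int_insert_left)
  qed
  then have "(\<Sum>e\<in>H. (if en e \<subseteq> V - S then 1 else 0) + card (en e \<inter> S))
      = (\<Sum>e\<in>H. 1 + (if en e \<subseteq> S then 1 else 0))" by (intro sum.cong) auto
  ultimately show ?thesis by (simp only: sum.distrib card_eq_sum)
qed

lemma handshake:
  assumes "H \<subseteq> E"
  shows "(\<Sum>v\<in>V. deg en H v) = 2 * card H"
proof -
  have "induced en H (V - V) = {}"
    using induced_singleton[OF assms] by (auto simp: induced_def)
  then show ?thesis using sum_deg[OF assms, of V] induced_V[OF assms] by simp
qed

end

section \<open>Splitting a tight graph into two connected graphs\<close>

lemma connects_insert:
  assumes "connects en U C" "en e = {v, a}" "a \<in> U"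
  shows "connects en (insert v U) (insert e C)"
proof -
  let ?R = "(adjacent en (insert e C))\<^sup>*"
  have mono: "(adjacent en C)\<^sup>* \<subseteq> ?R"
    by (intro rtrancl_mono) (auto simp: adjacent_def)
  have "(v, a) \<in> ?R" "(a, v) \<in> ?R" using assms(2) by (auto simp: adjacent_def insert_commute)
  moreover have "(x, y) \<in> ?R" if "x \<in> U" "y \<in> U" for x y
    using assms(1) that mono by (auto simp: connects_def)
  ultimately show ?thesis using assms(3) unfolding connects_def
    by (metis insert_iff rtrancl.rtrancl_refl rtrancl_trans)
qed

text \<open>In the assumption \<open>e\<close> is redrawn as an edge from \<open>a\<close> to
  \<open>b\<close>. Undoing this replaces it by the path \<open>e\<close>, \<open>f\<close> through
  \<open>v\<close>; if \<open>e\<close> is not in \<open>C\<close>, the two edges merely attach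
  \<open>v\<close>.\<close>

lemma connects_subdivide:
  assumes conn: "connects (en(e := {a, b})) U C" and e: "en e = {v, a}" and f: "en f = {v, b}" "a \<in> U"
  shows "connects en (insert v U) (insert e (insert f C))"
proof -
  let ?C = "insert e (insert f C)"
  let ?R = "(adjacent en ?C)\<^sup>*"
  have va: "(v, a) \<in> ?R" "(a, v) \<in> ?R" and vb: "(v, b) \<in> ?R" "(b, v) \<in> ?R"
    using e f by (auto simp: adjacent_def insert_commute)
  then have ab: "(a, b) \<in> ?R" "(b, a) \<in> ?R" by (meson rtrancl_trans)+
  have "adjacent (en(e := {a, b})) C \<subseteq> ?R"
  proof clarify
    fix x y assume "(x, y) \<in> adjacent (en(e := {a, b})) C"
    then obtain g where g: "g \<in> C" "(en(e := {a, b})) g = {x, y}" by (auto simp: adjacent_def)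
    show "(x, y) \<in> ?R"
    proof (cases "g = e")
      case True
      then show ?thesis using g ab by (auto simp: doubleton_eq_iff)
    next
      case False
      then show ?thesis using g by (auto simp: adjacent_def)
    qed
  qed
  then have "(adjacent (en(e := {a, b})) C)\<^sup>* \<subseteq> ?R" by (rule rtrancl_subset_rtrancl)
  then have "(x, y) \<in> ?R" if "x \<in> U" "y \<in> U" for x y
    using conn that by (auto simp: connects_def)
  then show ?thesis using va f(2) unfolding connects_def
    by (metis insert_iff rtrancl.rtrancl_refl rtrancl_trans)
qed

context edge_system
begin

text \<open>The degrees sum to 4|V| - 4, so some degree is at most 3. If it were below 2, the
  remaining vertices would span more than 2(|V| - 1) - 2 edges.\<close>

lemma sparse_degree_bounds:
  assumes "H \<subseteq> E" "sparse en V H" "tight en H V" "card V \<ge> 2"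
  obtains v where "v \<in> V" "deg en H v = 2 \<or> deg en H v = 3"
proof -
  have "\<exists>v\<in>V. deg en H v \<le> 3"
  proof (rule ccontr)
    assume "\<not> ?thesis"
    then have "(\<Sum>v\<in>V. deg en H v) \<ge> (\<Sum>v\<in>V. 4)" by (intro sum_mono) auto
    then have "4 * card V \<le> 2 * card H" using handshake[OF assms(1)] by simp
    then show False using assms(3,4) induced_V[OF assms(1)] by (simp add: tight_def)
  qed
  then obtain v where v: "v \<in> V" "deg en H v \<le> 3" by blast
  have n: "card V = Suc (card (V - {v}))" using v(1) finite_V by (metis card_Suc_Diff1)
  then have "card (V - {v}) \<noteq> 0" using assms(4) by linarith
  then have "V - {v} \<noteq> {}" by (metis card.empty)
  then have "card (induced en H (V - {v})) + 2 \<le> 2 * card (V - {v})"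
    using sparseD[OF assms(2), of "V - {v}"] by blast
  moreover have "card (induced en H (V - {v})) + deg en H v = card H"
    using sum_deg[of H "{v}"] v(1) assms(1) by (simp add: induced_singleton)
  ultimately have "deg en H v \<ge> 2"
    using assms(3) n induced_V[OF assms(1)] by (simp add: tight_def)
  then show thesis using that v by force
qed

lemma sparse_on_subset:
  assumes "sparse en V H" "U \<subseteq> V" shows "sparse en U (induced en H U)"
proof -
  have "induced en (induced en H U) X = induced en H X" if "X \<subseteq> U" for X
    using that by (auto simp: induced_def)
  then show ?thesis using assms by (auto simp: sparse_def)
qed

lemma edge_system_induced: "H \<subseteq> E \<Longrightarrow> U \<subseteq> V \<Longrightarrow> edge_system U (induced en H U) en"
  using finite_V finite_E card_en unfolding induced_def by unfold_locales (auto intro: finite_subset)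

text \<open>If every pair of distinct neighbours of \<open>v\<close> lay in a tight set avoiding \<open>v\<close>, then the union
  of these sets would be tight and would, together with \<open>v\<close>, span too many edges.\<close>

lemma cubic_vertex_splits:
  assumes H: "H \<subseteq> E" "sparse en V H" and v: "v \<in> V" "deg en H v = 3"
  obtains e f g a b where "{h \<in> H. v \<in> en h} = {e, f, g}" "e \<noteq> f" "e \<noteq> g" "f \<noteq> g"
    "en e = {v, a}" "en f = {v, b}" "a \<noteq> b" "a \<noteq> v" "b \<noteq> v"
    "\<forall>X. X \<subseteq> V - {v} \<longrightarrow> tight en H X \<longrightarrow> \<not> {a, b} \<subseteq> X"
proof (rule ccontr)
  assume "\<not> thesis"
  note no = this[unfolded not_def, rule_format, OF that]
  obtain e1 e2 e3 where star: "{h \<in> H. v \<in> en h} = {e1, e2, e3}" "e1 \<noteq> e2" "e1 \<noteq> e3" "e2 \<noteq> e3"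
    using v(2) unfolding deg_def card_3_iff by metis
  then have e: "e1 \<in> E" "e2 \<in> E" "e3 \<in> E" "v \<in> en e1" "v \<in> en e2" "v \<in> en e3" using H(1) by blast+
  obtain a1 where a1: "a1 \<in> V" "a1 \<noteq> v" "en e1 = {v, a1}" by (rule other_end[OF e(1,4)])
  obtain a2 where a2: "a2 \<in> V" "a2 \<noteq> v" "en e2 = {v, a2}" by (rule other_end[OF e(2,5)])
  obtain a3 where a3: "a3 \<in> V" "a3 \<noteq> v" "en e3 = {v, a3}" by (rule other_end[OF e(3,6)])
  have t12: "\<exists>X \<subseteq> V - {v}. tight en H X \<and> {a1, a2} \<subseteq> X" if "a1 \<noteq> a2"
    using no[of e1 e2 e3 a1 a2] star a1 a2 that by blast
  have t13: "\<exists>X \<subseteq> V - {v}. tight en H X \<and> {a1, a3} \<subseteq> X" if "a1 \<noteq> a3"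
    using no[of e1 e3 e2 a1 a3] star a1 a3 that by (metis insert_commute)
  have fin: "finite H" using H(1) finite_sub by blast
  \<comment> \<open>With the three edges at \<open>v\<close>, the set \<open>insert v X\<close>
    would span 2|X| + 1 edges, where only 2|X| are allowed.\<close>
  have too_many: False if X: "X \<subseteq> V - {v}" "tight en H X" "a1 \<in> X" "a2 \<in> X" "a3 \<in> X" for X
  proof -
    have "{e1, e2, e3} \<union> induced en H X \<subseteq> induced en H (insert v X)"
      using star a1 a2 a3 X by (auto simp: induced_def)
    then have "card ({e1, e2, e3} \<union> induced en H X) \<le> card (induced en H (insert v X))"
      using fin by (intro card_mono) auto
    moreover have "{e1, e2, e3} \<inter> induced en H X = {}"
      using X(1) e by (auto simp: induced_def)
    then have "card ({e1, e2, e3} \<union> induced en H X) = 3 + card (induced en H X)"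
      using fin star by (subst card_Un_disjoint) auto
    moreover have "card (induced en H (insert v X)) + 2 \<le> 2 * card (insert v X)"
      using X v H by (intro sparseD) auto
    moreover have "card (insert v X) = Suc (card X)"
      using X finite_V by (subst card_insert_disjoint) (auto intro: finite_subset)
    ultimately show False using X(2) by (simp add: tight_def)
  qed
  have singleton: "{a1} \<subseteq> V - {v}" "tight en H {a1}"
    using a1 tight_singleton[OF H(1)] by auto
  \<comment> \<open>If two of the three edges are parallel, the singleton of their common neighbour
    serves as the tight set. \<open>X\<close> and \<open>Y\<close> meet in
    \<open>a1\<close>.\<close>
  obtain X where X: "X \<subseteq> V - {v}" "tight en H X" "{a1, a2} \<subseteq> X"
    using t12 singleton by (cases "a1 = a2") auto
  obtain Y where Y: "Y \<subseteq> V - {v}" "tight en H Y" "{a1, a3} \<subseteq> Y"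
    using t13 singleton by (cases "a1 = a3") auto
  have "tight en H (X \<union> Y)"
    using X Y by (intro tight_Int_Un(2)[OF H]) auto
  then show False using too_many[of "X \<union> Y"] X Y by auto
qed

end

text \<open>Remove a vertex of degree 2 or 3 and apply induction. Degree 2: each connected set
  receives one of the two edges. Degree 3: two of the edges are first split off into one edge
  between their other ends; afterwards that edge is subdivided by \<open>v\<close> again, and the
  third edge attaches \<open>v\<close> to the other set.\<close>

lemma tight_two_connected:
  assumes "edge_system V H en" "sparse en V H" "tight en H V"
  shows "\<exists>C D. C \<subseteq> H \<and> D \<subseteq> H \<and> C \<inter> D = {} \<and> connects en V C \<and> connects en V D"
  using assms
\<comment> \<open>\<open>en\<close> has to vary too, because splitting off changes the ends of an
  edge.\<close>
proof (induction "card V" arbitrary: V H en rule: less_induct)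
  case less
  interpret edge_system V H en by (rule less.prems)
  note HV = induced_V[OF subset_refl]
  show ?case
  proof (cases "card V \<ge> 2")
    case False
    moreover have "V \<noteq> {}" using less.prems(3) by (auto simp: tight_def)
    ultimately have "card V = 1" using finite_V by (metis One_nat_def Suc_1 card_0_eq le_Suc_eq less_Suc_eq_le less_one linorder_not_less)
    then obtain v where "V = {v}" by (auto simp: card_1_singleton_iff)
    then have "connects en V {}" by (auto simp: connects_def)
    then show ?thesis by blast
  next
    case True
    obtain v where v: "v \<in> V" "deg en H v = 2 \<or> deg en H v = 3"
      using sparse_degree_bounds[OF subset_refl less.prems(2,3) True] .
    let ?U = "V - {v}" let ?K = "induced en H ?U"
    have n: "card V = Suc (card ?U)" using v(1) finite_V by (metis card_Suc_Diff1)
    have "card ?U \<noteq> 0" using True n by linarith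
    then have U: "?U \<noteq> {}" by (metis card.empty)
    have VU: "insert v ?U = V" using v(1) by blast
    have count: "card ?K + deg en H v = card H"
      using sum_deg[of H "{v}"] v(1) by (simp add: induced_singleton)
    have cH: "card H + 2 = 2 * card V" using less.prems(3) HV by (simp add: tight_def)
    have sK: "sparse en ?U ?K" by (rule sparse_on_subset[OF less.prems(2)]) auto
    have eK: "edge_system ?U ?K en" by (rule edge_system_induced) auto
    show ?thesis using v(2)
    proof
      assume "deg en H v = 2"
      then obtain e f where star: "{h \<in> H. v \<in> en h} = {e, f}" "e \<noteq> f"
        unfolding deg_def card_2_iff by blast
      then have ef: "e \<in> H" "f \<in> H" "v \<in> en e" "v \<in> en f" by blast+
      obtain a where a: "a \<in> V" "a \<noteq> v" "en e = {v, a}" by (rule other_end[OF ef(1,3)])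
      obtain b where b: "b \<in> V" "b \<noteq> v" "en f = {v, b}" by (rule other_end[OF ef(2,4)])
      have "tight en ?K ?U"
        using edge_system.induced_V[OF eK subset_refl] U count cH n \<open>deg en H v = 2\<close> by (simp add: tight_def)
      then obtain C D where CD: "C \<subseteq> ?K" "D \<subseteq> ?K" "C \<inter> D = {}" "connects en ?U C" "connects en ?U D"
        using less.hyps[OF _ eK sK] n by auto
      have "a \<in> ?U" "b \<in> ?U" using a b by auto
      then have "connects en V (insert e C)" "connects en V (insert f D)"
        using connects_insert[OF CD(4) a(3)] connects_insert[OF CD(5) b(3)] unfolding VU by blast+
      moreover have "e \<notin> ?K" "f \<notin> ?K" using ef by (auto simp: induced_def)
      moreover have "?K \<subseteq> H" by (auto simp: induced_def)
      ultimately show ?thesis using CD(1-3) ef star(2)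
        by (intro exI[of _ "insert e C"] exI[of _ "insert f D"]) auto
    next
      assume deg3: "deg en H v = 3"
      obtain e f g a b where star: "{h \<in> H. v \<in> en h} = {e, f, g}" "e \<noteq> f" "e \<noteq> g" "f \<noteq> g"
        and ab: "en e = {v, a}" "en f = {v, b}" "a \<noteq> b" "a \<noteq> v" "b \<noteq> v"
        and free: "\<forall>X. X \<subseteq> V - {v} \<longrightarrow> tight en H X \<longrightarrow> \<not> {a, b} \<subseteq> X"
        by (rule cubic_vertex_splits[OF subset_refl less.prems(2) v(1) deg3])
      have efg: "e \<in> H" "f \<in> H" "g \<in> H" "v \<in> en g" using star by blast+
      then have abU: "a \<in> ?U" "b \<in> ?U" using ab en_subset by blast+
      obtain c where c: "c \<in> V" "c \<noteq> v" "en g = {v, c}" by (rule other_end[OF efg(3,4)])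
      \<comment> \<open>The split-off edge takes over the identity of \<open>e\<close>, so no fresh
        edge is required.\<close>
      define en' where "en' = en(e := {a, b})"
      let ?L = "insert e ?K"
      have nK: "e \<notin> ?K" "f \<notin> ?K" "g \<notin> ?K" using efg ab by (auto simp: induced_def)
      then have ind: "induced en' ?K X = induced en ?K X" for X
        by (auto simp: induced_def en'_def)
      interpret K: edge_system ?U ?K en by (rule eK)
      interpret L: edge_system ?U ?L en'
      proof
        fix h assume "h \<in> ?L"
        then show "en' h \<subseteq> ?U" "card (en' h) = 2"
          using abU ab(3) K.en_subset[of h] K.card_en[of h] by (auto simp: en'_def)
      qed (use K.finite_V K.finite_E in auto)
      have "\<not> en' e \<subseteq> X" if X: "X \<subseteq> ?U" "tight en' ?K X" for X
      proof -
        have "induced en ?K X = induced en H X" using X(1) by (auto simp: induced_def)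
        then have "tight en H X" using X(2) unfolding tight_def ind by simp
        then show ?thesis using free X(1) by (simp add: en'_def)
      qed
      moreover have "sparse en' ?U ?K" using sK by (simp add: sparse_def ind)
      ultimately have "sparse en' ?U ?L"
        using K.finite_E by (intro L.sparse_insert) blast+
      \<comment> \<open>Three edges go and one comes: 2|V| - 2 - 3 + 1 = 2(|V| - 1) - 2.\<close>
      moreover have "tight en' ?L ?U"
        using U count cH n deg3 nK(1) K.finite_E
        unfolding tight_def L.induced_V[OF subset_refl] by simp
      ultimately obtain C D where CD: "C \<subseteq> ?L" "D \<subseteq> ?L" "C \<inter> D = {}"
          "connects en' ?U C" "connects en' ?U D"
        using less.hyps[OF _ L.edge_system_axioms] n by auto
      \<comment> \<open>By symmetry \<open>D\<close> may be taken to avoid \<open>e\<close>. Its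
        edges keep their ends under \<open>en'\<close>, so it can be extended by \<open>g\<close>,
        while \<open>C\<close> receives \<open>e\<close> and \<open>f\<close>.\<close>
      have main: ?thesis if CD: "C \<subseteq> ?L" "D \<subseteq> ?L" "C \<inter> D = {}" "e \<notin> D"
          "connects en' ?U C" "connects en' ?U D" for C D
      proof -
        have "adjacent en' D = adjacent en D"
          using CD(4) unfolding adjacent_def en'_def by (metis fun_upd_apply)
        then have "connects en ?U D" using CD(6) by (simp add: connects_def)
        moreover have "c \<in> ?U" using c by simp
        ultimately have "connects en V (insert g D)"
          using connects_insert[of en ?U D g v c] c(3) unfolding VU by blast
        moreover have "connects en V (insert e (insert f C))"
          using connects_subdivide[OF CD(5)[unfolded en'_def] ab(1,2) abU(1)] unfolding VU .
        moreover have "?K \<subseteq> H" by (auto simp: induced_def)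
        ultimately show ?thesis using CD(1-4) nK star(2-4) efg
          by (intro exI[of _ "insert e (insert f C)"] exI[of _ "insert g D"]) auto
      qed
      show ?thesis
      proof (cases "e \<in> D")
        case True
        then show ?thesis using main[of D C] CD by blast
      next
        case False
        then show ?thesis using main[of C D] CD by blast
      qed
    qed
  qed
qed

section \<open>Parity joins\<close>

lemma odd_card_sym_diff:
  assumes "finite A" "finite B"
  shows "odd (card (sym_diff A B)) \<longleftrightarrow> odd (card A) \<noteq> odd (card B)"
proof -
  have "card (sym_diff A B) = card (A - B) + card (B - A)"
    using assms by (intro card_Un_disjoint) auto
  moreover have "card A = card (A - B) + card (A \<inter> B)" "card B = card (B - A) + card (A \<inter> B)"
    using assms by (metis card_Int_Diff add.commute, metis card_Int_Diff add.commute Int_commute)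
  ultimately show ?thesis by auto
qed

lemma odd_deg_sym_diff:
  assumes "finite A" "finite B"
  shows "odd (deg en (sym_diff A B) v) \<longleftrightarrow> odd (deg en A v) \<noteq> odd (deg en B v)"
proof -
  have "{e \<in> sym_diff A B. v \<in> en e} = sym_diff {e \<in> A. v \<in> en e} {e \<in> B. v \<in> en e}" by auto
  then show ?thesis using assms by (simp add: deg_def odd_card_sym_diff)
qed

lemma deg_Un_disjoint:
  assumes "finite A" "finite B" "A \<inter> B = {}"
  shows "deg en (A \<union> B) v = deg en A v + deg en B v"
proof -
  have "{e \<in> A \<union> B. v \<in> en e} = {e \<in> A. v \<in> en e} \<union> {e \<in> B. v \<in> en e}" by auto
  then show ?thesis using assms unfolding deg_def by (auto intro!: card_Un_disjoint)
qed

lemma deg_mono: "finite B \<Longrightarrow> A \<subseteq> B \<Longrightarrow> deg en A v \<le> deg en B v"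
  unfolding deg_def by (intro card_mono) auto

context edge_system
begin

text \<open>Follow a walk and add its edges modulo 2, so that repeated edges cancel. The inequality
  of truth values also covers \<open>u = v\<close>, where no degree is odd.\<close>

lemma path_join:
  assumes "C \<subseteq> E" "(u, v) \<in> (adjacent en C)\<^sup>*"
  shows "\<exists>J \<subseteq> C. \<forall>x. odd (deg en J x) \<longleftrightarrow> (x = u) \<noteq> (x = v)"
  using assms(2)
proof induction
  case base
  then show ?case by (intro exI[of _ "{}"]) (simp add: deg_def)
next
  case (step v w)
  then obtain J e where J: "J \<subseteq> C" "\<forall>x. odd (deg en J x) \<longleftrightarrow> (x = u) \<noteq> (x = v)"
    and e: "e \<in> C" "en e = {v, w}" by (auto simp: adjacent_def)
  have "v \<noteq> w" using card_en[of e] e assms(1) by auto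
  have "deg en {e} x = (if x \<in> {v, w} then 1 else 0)" for x
    using e by (auto simp: deg_def Collect_conv_if)
  moreover have "finite J" using J(1) assms(1) finite_sub by blast
  ultimately have "odd (deg en (sym_diff J {e}) x) \<longleftrightarrow> (x = u) \<noteq> (x = w)" for x
    using odd_deg_sym_diff[of J "{e}" en x] J(2) \<open>v \<noteq> w\<close> by auto
  then show ?case using J(1) e(1) by (intro exI[of _ "sym_diff J {e}"]) auto
qed

text \<open>Pair off the vertices of \<open>R\<close> and add modulo 2 the joins of the
  pairs.\<close>

lemma parity_join:
  assumes "C \<subseteq> E" "connects en V C" "R \<subseteq> V" "even (card R)"
  shows "\<exists>J \<subseteq> C. \<forall>x. odd (deg en J x) \<longleftrightarrow> x \<in> R"
  using assms(3,4)
proof (induction "card R" arbitrary: R rule: less_induct)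
  case less
  have fin: "finite R" using less.prems finite_V finite_subset by blast
  show ?case
  proof (cases "R = {}")
    case True
    then show ?thesis by (intro exI[of _ "{}"]) (simp add: deg_def)
  next
    case False
    then obtain u where u: "u \<in> R" by blast
    then have n: "card R = Suc (card (R - {u}))" using fin by (metis card_Suc_Diff1)
    then have "card (R - {u}) \<noteq> 0" using less.prems(2) by presburger
    then obtain v where v: "v \<in> R - {u}" by (metis card.empty ex_in_conv)
    let ?Q = "R - {u} - {v}"
    have m: "card (R - {u}) = Suc (card ?Q)" using fin v by (metis card_Suc_Diff1 finite_Diff)
    have "card ?Q < card R" "even (card ?Q)" using less.prems(2) n m by presburger+
    moreover have "?Q \<subseteq> V" using less.prems(1) by blast
    ultimately obtain J where J: "J \<subseteq> C" "\<forall>x. odd (deg en J x) \<longleftrightarrow> x \<in> ?Q"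
      using less.hyps[of ?Q] by blast
    have "u \<in> V" "v \<in> V" using u v less.prems(1) by blast+
    then have "(u, v) \<in> (adjacent en C)\<^sup>*" using assms(2) unfolding connects_def by blast
    from path_join[OF assms(1) this]
    obtain K where K: "K \<subseteq> C" "\<forall>x. odd (deg en K x) \<longleftrightarrow> (x = u) \<noteq> (x = v)" by blast
    have "finite J" "finite K" using J(1) K(1) assms(1) finite_sub by blast+
    then have "odd (deg en (sym_diff J K) x) \<longleftrightarrow> x \<in> R" for x
      using odd_deg_sym_diff[of J K en x] J(2)[rule_format, of x] K(2)[rule_format, of x] u v
      by blast
    then show ?thesis using J(1) K(1) by (intro exI[of _ "sym_diff J K"]) auto
  qed
qed

lemma even_connected_subset:
  assumes "C \<subseteq> E" "D \<subseteq> E" "C \<inter> D = {}" "connects en V C" "connects en V D"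
  shows "\<exists>F. C \<subseteq> F \<and> F \<subseteq> C \<union> D \<and> (\<forall>v. even (deg en F v))"
proof -
  define R where "R = {v \<in> V. odd (deg en C v)}"
  have "even (\<Sum>v\<in>V. deg en C v)" using handshake[OF assms(1)] by simp
  then have ev: "even (card R)" unfolding even_sum_iff[OF finite_V] R_def .
  have RV: "R \<subseteq> V" by (auto simp: R_def)
  from parity_join[OF assms(2,5) RV ev]
  obtain J where J: "J \<subseteq> D" "\<forall>x. odd (deg en J x) \<longleftrightarrow> x \<in> R" by blast
  have fin: "finite C" "finite J" using J(1) assms(1,2) finite_sub by blast+
  have "even (deg en (C \<union> J) v)" for v
  proof -
    have "C \<inter> J = {}" using J(1) assms(3) by blast
    then have "deg en (C \<union> J) v = deg en C v + deg en J v" by (rule deg_Un_disjoint[OF fin])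
    moreover have "deg en C v = 0" if "v \<notin> V"
    proof -
      have "{e \<in> C. v \<in> en e} = {}" using that en_subset assms(1) by blast
      then show ?thesis unfolding deg_def by (simp only: card.empty)
    qed
    ultimately show ?thesis using J(2)[rule_format, of v] by (cases "v \<in> V") (auto simp: R_def)
  qed
  then show ?thesis using J(1) by blast
qed

end

section \<open>Partitions of the vertices outside a set\<close>

text \<open>The classes of a vertex in \<open>A\<close> are the same in the two graphs, since no edge leaves \<open>A\<close>.\<close>

lemma num_components_disjoint_union:
  assumes fin: "finite (verts G)" and K: "verts G = A \<union> K" "A \<inter> K = {}" "K \<noteq> {}"
    and A: "verts H = A"
    and adj: "\<And>u v. u \<in> A \<Longrightarrow> (u, v) \<in> adj_rel G \<longleftrightarrow> (u, v) \<in> adj_rel H"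
    and closed: "\<And>u v. u \<in> A \<Longrightarrow> (u, v) \<in> adj_rel G \<Longrightarrow> v \<in> A"
  shows "num_components H + 1 \<le> num_components G"
proof -
  have one: "v \<in> A \<and> (u, v) \<in> (adj_rel H)\<^sup>*" if "(u, v) \<in> (adj_rel G)\<^sup>*" "u \<in> A" for u v
    using that
  proof induction
    case base
    then show ?case by simp
  next
    case (step v w)
    then show ?case using adj closed by (meson rtrancl.rtrancl_into_rtrancl)
  qed
  have two: "v \<in> A \<and> (u, v) \<in> (adj_rel G)\<^sup>*" if "(u, v) \<in> (adj_rel H)\<^sup>*" "u \<in> A" for u v
    using that
  proof induction
    case base
    then show ?case by simp
  next
    case (step v w)
    then show ?case using adj closed by (meson rtrancl.rtrancl_into_rtrancl)
  qed
  have class_eq: "joined_rel G `` {u} = joined_rel H `` {u}" if u: "u \<in> A" for u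
  proof -
    have "(u, v) \<in> joined_rel G \<longleftrightarrow> (u, v) \<in> joined_rel H" for v
      using one[of u v] two[of u v] u A K(1) unfolding joined_rel_def by blast
    then show ?thesis by blast
  qed
  obtain k where k: "k \<in> K" using K(3) by blast
  let ?k = "joined_rel G `` {k}"
  have "components H \<subseteq> components G"
  proof
    fix B assume "B \<in> components H"
    then obtain u where u: "u \<in> A" "B = joined_rel H `` {u}"
      unfolding components_def A by (rule quotientE)
    then have "B = joined_rel G `` {u}" using class_eq by simp
    moreover have "u \<in> verts G" using u(1) K(1) by blast
    ultimately show "B \<in> components G" unfolding components_def by (metis quotientI)
  qed
  \<comment> \<open>The class of a vertex of \<open>K\<close> is the additional component.
    \<open>K\<close> may contain several, hence only an inequality.\<close>
  moreover have "?k \<in> components G" using k K(1) by (simp add: components_def quotientI)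
  ultimately have "insert ?k (components H) \<subseteq> components G" by blast
  moreover have "finite (components G)"
    using fin unfolding components_def quotient_def by blast
  ultimately have "card (insert ?k (components H)) \<le> card (components G)"
    "finite (components H)"
    by (auto intro: card_mono finite_subset)
  moreover have "?k \<notin> components H"
  proof
    assume "?k \<in> components H"
    then obtain u where u: "?k = joined_rel H `` {u}"
      unfolding components_def by (rule quotientE)
    have "k \<in> ?k" using k K(1) by (simp add: joined_rel_def)
    then have "k \<in> joined_rel H `` {u}" by (simp only: u)
    then have "k \<in> verts H" unfolding joined_rel_def by blast
    then show False using k K(2) A by blast
  qed
  ultimately show ?thesis by (simp add: num_components_def)
qed

section \<open>Components and isolated vertices of induced subgraphs\<close>

sublocale multigraph \<subseteq> edge_system "verts G" "edges G" "ends G"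
  by unfold_locales (use finite_verts finite_edges ends_subset card_ends in auto)

context multigraph
begin

text \<open>The subgraph induced by \<open>U\<close>, written as a deletion so that the hypothesis
  of the theorem applies to it directly.\<close>

definition sub :: "'v set \<Rightarrow> ('v, 'e) mgraph" where
  "sub U = delete_verts G (verts G - U)"

lemma verts_sub: "U \<subseteq> verts G \<Longrightarrow> verts (sub U) = U"
  by (auto simp: sub_def delete_verts_def)

lemma edges_sub: "edges (sub U) = induced (ends G) (edges G) U"
  using ends_subset by (auto simp: sub_def delete_verts_def induced_def)

lemma ends_sub: "ends (sub U) = ends G"
  by (simp add: sub_def delete_verts_def)

lemma degree_sub: "degree (sub U) v = deg (ends G) (induced (ends G) (edges G) U) v"
  by (simp add: degree_def deg_def edges_sub ends_sub)

text \<open>No edge joins \<open>A\<close> to \<open>K\<close>, so vertices of \<open>A\<close> have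
  the same edges in both subgraphs, and \<open>K\<close> brings at least one component of its
  own.\<close>

lemma components_isolated_union:
  assumes "A \<union> K \<subseteq> verts G" "A \<inter> K = {}" "K \<noteq> {}"
    and sep: "\<And>e. e \<in> edges G \<Longrightarrow> ends G e \<subseteq> A \<union> K \<Longrightarrow> ends G e \<subseteq> A \<or> ends G e \<subseteq> K"
  shows "num_components (sub A) + 1 \<le> num_components (sub (A \<union> K))"
    and "num_isolated (sub A) \<le> num_isolated (sub (A \<union> K))"
    and "K = {x} \<Longrightarrow> num_isolated (sub A) + 1 \<le> num_isolated (sub (A \<union> K))"
proof -
  have AV: "A \<subseteq> verts G" using assms(1) by blast
  note vs = verts_sub[OF AV] verts_sub[OF assms(1)]
  have fin: "finite A" "finite (A \<union> K)" using assms(1) AV finite_verts finite_subset by blast+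
  have edge: "e \<in> induced (ends G) (edges G) (A \<union> K) \<longleftrightarrow> e \<in> induced (ends G) (edges G) A"
    if "u \<in> A" "u \<in> ends G e" for e u
    using that sep[of e] assms(2) unfolding induced_def by blast
  have adj: "(u, v) \<in> adj_rel (sub (A \<union> K)) \<longleftrightarrow> (u, v) \<in> adj_rel (sub A)" if "u \<in> A" for u v
    using edge[OF that] unfolding adj_rel_def edges_sub ends_sub by blast
  show "num_components (sub A) + 1 \<le> num_components (sub (A \<union> K))"
  proof (rule num_components_disjoint_union[OF _ vs(2) assms(2,3) vs(1) adj])
    show "finite (verts (sub (A \<union> K)))" using vs(2) fin(2) by simp
    fix u v assume "u \<in> A" "(u, v) \<in> adj_rel (sub (A \<union> K))"
    then have "(u, v) \<in> adj_rel (sub A)" using adj by blast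
    then show "v \<in> A" unfolding adj_rel_def edges_sub ends_sub induced_def by blast
  qed
  have deg_eq: "degree (sub (A \<union> K)) v = degree (sub A) v" if "v \<in> A" for v
  proof -
    have "{e \<in> induced (ends G) (edges G) (A \<union> K). v \<in> ends G e}
        = {e \<in> induced (ends G) (edges G) A. v \<in> ends G e}" using edge[OF that] by blast
    then show ?thesis by (simp only: degree_sub deg_def)
  qed
  let ?I = "{v \<in> A. degree (sub A) v = 0}" and ?J = "{v \<in> A \<union> K. degree (sub (A \<union> K)) v = 0}"
  have IJ: "?I \<subseteq> ?J" using deg_eq by auto
  have finJ: "finite ?J" using fin(2) by simp
  show "num_isolated (sub A) \<le> num_isolated (sub (A \<union> K))"
    unfolding num_isolated_def vs by (rule card_mono[OF finJ IJ])
  assume Kx: "K = {x}"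
  have "degree (sub (A \<union> K)) x = 0"
  proof -
    have "{e \<in> induced (ends G) (edges G) (A \<union> K). x \<in> ends G e} = {}"
    proof (intro equals0I, clarify)
      fix e assume e: "e \<in> induced (ends G) (edges G) (A \<union> K)" "x \<in> ends G e"
      then have "ends G e \<subseteq> K"
        using sep[of e] assms(2) Kx unfolding induced_def by blast
      then have "e \<in> induced (ends G) (edges G) {x}" using e Kx unfolding induced_def by blast
      then show False using induced_singleton[OF subset_refl] by blast
    qed
    then show ?thesis unfolding degree_sub deg_def by (simp only: card.empty)
  qed
  then have "x \<in> ?J" using Kx by simp
  then have "insert x ?I \<subseteq> ?J" using IJ by (rule insert_subsetI)
  then have "card (insert x ?I) \<le> card ?J" using finJ by (rule card_mono[rotated])
  moreover have "card (insert x ?I) = card ?I + 1" using fin(1) assms(2) Kx by simp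
  ultimately show "num_isolated (sub A) + 1 \<le> num_isolated (sub (A \<union> K))"
    unfolding num_isolated_def vs by linarith
qed

text \<open>The hypothesis of the theorem bounds this by \<open>|V - U| + 2\<close>.\<close>

definition weight :: "'v set \<Rightarrow> nat" where
  "weight U = 2 * num_components (sub U) + 3 * num_isolated (sub U)"

text \<open>A new component is worth 2; a new isolated vertex is worth 2 + 3.\<close>

lemma weight_Un:
  assumes "A \<union> K \<subseteq> verts G" "A \<inter> K = {}" "K \<noteq> {}"
    and "\<And>e. e \<in> edges G \<Longrightarrow> ends G e \<subseteq> A \<union> K \<Longrightarrow> ends G e \<subseteq> A \<or> ends G e \<subseteq> K"
  shows "weight A + 2 \<le> weight (A \<union> K)"
    and "K = {x} \<Longrightarrow> weight A + 5 \<le> weight (A \<union> K)"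
  using components_isolated_union[OF assms] unfolding weight_def by fastforce+

end

section \<open>From partitions to vertex deletions\<close>

context multigraph
begin

abbreviation span :: "'v set \<Rightarrow> 'e set" where
  "span U \<equiv> induced (ends G) (edges G) U"

lemma card_span_Diff:
  "card (span U) = card (span (U - D)) + card {e \<in> span U. ends G e \<inter> D \<noteq> {}}"
proof -
  have "span U = span (U - D) \<union> {e \<in> span U. ends G e \<inter> D \<noteq> {}}"
    by (auto simp: induced_def)
  moreover have "span (U - D) \<inter> {e \<in> span U. ends G e \<inter> D \<noteq> {}} = {}"
    by (auto simp: induced_def)
  ultimately show ?thesis using finite_edges
    by (metis (no_types, lifting) card_Un_disjoint finite_Un finite_induced)
qed

definition nbrs :: "'v set \<Rightarrow> 'v \<Rightarrow> 'v set" where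
  "nbrs U x = {y. \<exists>e \<in> span U. x \<noteq> y \<and> ends G e = {x, y}}"

lemma card_nbrs_le: "card (nbrs U x) \<le> deg (ends G) (span U) x"
proof -
  have "nbrs U x \<subseteq> (\<lambda>e. the_elem (ends G e - {x})) ` {e \<in> span U. x \<in> ends G e}"
  proof
    fix y assume "y \<in> nbrs U x"
    then obtain e where e: "e \<in> span U" "x \<noteq> y" "ends G e = {x, y}" by (auto simp: nbrs_def)
    then have "ends G e - {x} = {y}" by auto
    then have "y = the_elem (ends G e - {x})" by simp
    then show "y \<in> (\<lambda>e. the_elem (ends G e - {x})) ` {e \<in> span U. x \<in> ends G e}"
      using e by blast
  qed
  then show ?thesis unfolding deg_def
    using finite_edges by (intro surj_card_le) auto
qed

text \<open>Put all n neighbours of \<open>x\<close> into \<open>Z\<close>, which isolates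
  \<open>x\<close>. Compared with the smaller set, the left side grows by 2(n + 1) + n, and the
  right side by 5 for \<open>x\<close> and by the edges meeting \<open>x\<close> or its neighbours.
  Hence the form of \<open>few\<close>.\<close>

lemma isolating_step:
  assumes U: "U \<subseteq> verts G" "x \<in> U"
    and few: "3 * card (nbrs U x) \<le> card {e \<in> span U. ends G e \<inter> insert x (nbrs U x) \<noteq> {}} + 3"
    and IH: "Z \<subseteq> U - insert x (nbrs U x)"
      "2 * card (U - insert x (nbrs U x)) + card Z
        \<le> card (span (U - insert x (nbrs U x))) + weight (U - insert x (nbrs U x) - Z)"
  shows "\<exists>Z \<subseteq> U. 2 * card U + card Z \<le> card (span U) + weight (U - Z)"
proof -
  let ?N = "nbrs U x" let ?D = "insert x ?N" let ?A = "U - ?D - Z"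
  have N: "?N \<subseteq> U" "x \<notin> ?N" by (auto simp: nbrs_def induced_def)
  have fin: "finite U" "finite ?N" "finite Z"
    using U(1) finite_verts N(1) IH(1) by (meson finite_subset finite_Diff)+
  have "card U = card (U - ?D) + card ?D"
    using fin N U(2) by (metis card_Diff_subset card_mono finite.insertI insert_subset le_add_diff_inverse2)
  moreover have "card ?D = card ?N + 1" using fin N by simp
  moreover have "card (?N \<union> Z) = card ?N + card Z"
    using fin IH(1) by (intro card_Un_disjoint) auto
  moreover have "weight ?A + 5 \<le> weight (?A \<union> {x})"
  proof (rule weight_Un(2)[OF _ _ _ _ refl])
    fix e assume e: "e \<in> edges G" "ends G e \<subseteq> ?A \<union> {x}"
    show "ends G e \<subseteq> ?A \<or> ends G e \<subseteq> {x}"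
    proof (cases "x \<in> ends G e")
      case True
      then obtain y where y: "y \<noteq> x" "ends G e = {x, y}" by (rule other_end[OF e(1)])
      then have "y \<in> ?N" using e U(2) by (auto simp: nbrs_def induced_def)
      then show ?thesis using y e(2) by blast
    qed (use e in blast)
  qed (use U in auto)
  moreover have "?A \<union> {x} = U - (?N \<union> Z)" using U(2) N(2) IH(1) by blast
  ultimately have "2 * card U + card (?N \<union> Z) \<le> card (span U) + weight (U - (?N \<union> Z))"
    using IH(2) few card_span_Diff[of U ?D] by simp
  moreover have "?N \<union> Z \<subseteq> U" using N IH(1) by blast
  ultimately show ?thesis by blast
qed

text \<open>At most one neighbour is paid for by the constant 3. Otherwise every vertex has exactly
  two neighbours, and three edges are needed: the two at \<open>x\<close> and a further one at a
  neighbour of \<open>x\<close>.\<close>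

lemma sparse_isolating_vertex:
  assumes U: "U \<subseteq> verts G" "U \<noteq> {}" and deg: "\<And>x. x \<in> U \<Longrightarrow> deg (ends G) (span U) x \<le> 2"
  obtains x where "x \<in> U"
    "3 * card (nbrs U x) \<le> card {e \<in> span U. ends G e \<inter> insert x (nbrs U x) \<noteq> {}} + 3"
proof (cases "\<exists>x\<in>U. card (nbrs U x) \<le> 1")
  case True
  then obtain x where "x \<in> U" "card (nbrs U x) \<le> 1" by blast
  then show thesis using that[of x] by simp
next
  case False
  have two: "card (nbrs U x) = 2" if "x \<in> U" for x
    using False card_nbrs_le[of U x] deg[OF that] that by force
  obtain x where x: "x \<in> U" using U(2) by blast
  obtain y z where yz: "nbrs U x = {y, z}" "y \<noteq> z" using two[OF x] unfolding card_2_iff by blast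
  then have "y \<in> nbrs U x" "z \<in> nbrs U x" by auto
  then obtain e1 e2 where e: "e1 \<in> span U" "x \<noteq> y" "ends G e1 = {x, y}"
    "e2 \<in> span U" "x \<noteq> z" "ends G e2 = {x, z}" unfolding nbrs_def by blast
  then have "y \<in> U" by (auto simp: induced_def)
  then obtain v w where "nbrs U y = {v, w}" "v \<noteq> w" using two unfolding card_2_iff by blast
  then obtain y' where "y' \<in> nbrs U y" "y' \<noteq> x" by blast
  then obtain e3 where e3: "e3 \<in> span U" "ends G e3 = {y, y'}" "y' \<noteq> y" unfolding nbrs_def by blast
  have "e1 \<noteq> e2" using e yz(2) by auto
  moreover have "e1 \<noteq> e3" using e e3 \<open>y' \<noteq> x\<close> by (auto simp: doubleton_eq_iff)
  moreover have "e2 \<noteq> e3" using e e3 yz(2) by (auto simp: doubleton_eq_iff)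
  ultimately have "card {e1, e2, e3} = 3" by simp
  moreover have "{e1, e2, e3} \<subseteq> {e \<in> span U. ends G e \<inter> insert x (nbrs U x) \<noteq> {}}"
    using e e3 yz(1) by auto
  then have "card {e1, e2, e3} \<le> card {e \<in> span U. ends G e \<inter> insert x (nbrs U x) \<noteq> {}}"
    using finite_edges by (intro card_mono) auto
  ultimately show thesis using that[OF x] two[OF x] by simp
qed

text \<open>This is the case of singleton parts in \<open>partition_weight\<close>. A vertex of
  degree at least 3 goes into \<open>Z\<close>: the left side grows by 3 and at least 3 edges pay
  for it. When all degrees are at most 2, some vertex can be isolated cheaply.\<close>

lemma vertex_weight:
  assumes "U \<subseteq> verts G"
  shows "\<exists>Z \<subseteq> U. 2 * card U + card Z \<le> card (span U) + weight (U - Z)"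
  using assms
proof (induction "card U" arbitrary: U rule: less_induct)
  case less
  have fin: "finite U" using less.prems finite_verts finite_subset by blast
  have IH: "\<exists>Z \<subseteq> U - D. 2 * card (U - D) + card Z \<le> card (span (U - D)) + weight (U - D - Z)"
    if "x \<in> D" "x \<in> U" for D x
  proof -
    have "U - D \<subset> U" using that by blast
    then show ?thesis using less.hyps[of "U - D"] less.prems fin by (meson psubset_card_mono psubset_imp_subset subset_trans)
  qed
  consider "U = {}" | x where "x \<in> U" "deg (ends G) (span U) x \<ge> 3"
    | "U \<noteq> {}" "\<And>x. x \<in> U \<Longrightarrow> deg (ends G) (span U) x \<le> 2"
    by (metis not_less_eq_eq numeral_2_eq_2 numeral_3_eq_3)
  then show ?case
  proof cases
    case 1
    then show ?thesis by simp
  next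
    case 2
    obtain Z where Z: "Z \<subseteq> U - {x}"
      "2 * card (U - {x}) + card Z \<le> card (span (U - {x})) + weight (U - {x} - Z)"
      using IH[of x "{x}"] 2(1) by blast
    have "card U = card (U - {x}) + 1" using fin 2(1) by (metis Suc_eq_plus1 card_Suc_Diff1)
    moreover have "card (insert x Z) = card Z + 1"
      using Z(1) fin by (subst card_insert_disjoint) (auto intro: finite_subset)
    moreover have "{e \<in> span U. ends G e \<inter> {x} \<noteq> {}} = {e \<in> span U. x \<in> ends G e}" by blast
    then have "card (span U) \<ge> card (span (U - {x})) + 3"
      using card_span_Diff[of U "{x}"] 2(2) by (simp add: deg_def)
    moreover have "U - insert x Z = U - {x} - Z" by blast
    ultimately have "2 * card U + card (insert x Z) \<le> card (span U) + weight (U - insert x Z)"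
      using Z(2) by simp
    then show ?thesis using Z(1) 2(1) by (intro exI[of _ "insert x Z"]) auto
  next
    case 3
    obtain x where x: "x \<in> U"
      "3 * card (nbrs U x) \<le> card {e \<in> span U. ends G e \<inter> insert x (nbrs U x) \<noteq> {}} + 3"
      using sparse_isolating_vertex[OF less.prems 3] by blast
    obtain Z where "Z \<subseteq> U - insert x (nbrs U x)"
      "2 * card (U - insert x (nbrs U x)) + card Z
        \<le> card (span (U - insert x (nbrs U x))) + weight (U - insert x (nbrs U x) - Z)"
      using IH[of x "insert x (nbrs U x)"] x(1) by blast
    then show ?thesis by (rule isolating_step[OF less.prems x])
  qed
qed

text \<open>If a crossing edge meets a part at \<open>x\<close> and the part has another vertex,
  \<open>x\<close> goes into \<open>Z\<close>, paid for by that edge. A part met by no crossing edge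
  is separated from the rest, so the gain of 2 in weight pays for it. If neither occurs, every part
  is a singleton.\<close>

lemma partition_weight:
  assumes "partition_on U P" "U \<subseteq> verts G"
  shows "\<exists>Z \<subseteq> U. 2 * card P + card Z \<le> card (cross (ends G) (edges G) P) + weight (U - Z)"
  using assms
proof (induction "card U" arbitrary: U P rule: less_induct)
  case less
  note P = partition_onD1[OF less.prems(1)] partition_onD2[OF less.prems(1)] partition_onD3[OF less.prems(1)]
  have fin: "finite U" using less.prems finite_verts finite_subset by blast
  have finP: "finite P" using finite_elements[OF fin less.prems(1)] .
  let ?X = "cross (ends G) (edges G)"
  have finX: "finite (?X Q)" for Q using finite_edges by (simp add: cross_def)
  consider (split) B x e where "B \<in> P" "x \<in> B" "e \<in> ?X P" "x \<in> ends G e" "B \<noteq> {x}"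
    | (drop) B where "B \<in> P" "\<And>e. e \<in> ?X P \<Longrightarrow> ends G e \<inter> B = {}"
    | (singletons) "\<And>B. B \<in> P \<Longrightarrow> \<exists>x. B = {x}"
    by blast
  then show ?case
  proof cases
    case split
    let ?P = "insert (B - {x}) (P - {B})" and ?U = "U - {x}"
    have disj: "B \<inter> C = {}" if "C \<in> P" "C \<noteq> B" for C
      using disjointD[OF P(2) split(1) that(1)] that(2) by blast
    have ne: "B - {x} \<noteq> {}" using split(2,5) by blast
    have xC: "x \<notin> C" if "C \<in> P" "C \<noteq> B" for C using disj[OF that] split(2) by blast
    have part: "partition_on ?U ?P"
    proof (rule partition_onI)
      show "\<Union>?P = ?U" using P(1) split(1) xC by blast
      show "{} \<notin> ?P" using ne P(3) by blast
      show "disjnt C D" if "C \<in> ?P" "D \<in> ?P" "C \<noteq> D" for C D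
        using that disj disjointD[OF P(2)] unfolding disjnt_def by blast
    qed
    \<comment> \<open>The shrunken part must not coincide with an old one, so that the number of
      parts is unchanged.\<close>
    have "B - {x} \<notin> P"
    proof
      assume "B - {x} \<in> P"
      moreover have "B - {x} \<noteq> B" using split(2) by blast
      ultimately show False using disj ne by blast
    qed
    then have cardP: "card ?P = card P"
      using finP split(1) by (metis Diff_iff card.remove card_insert_disjoint finite_Diff)
    have U: "x \<in> U" using split(1,2) P(1) by blast
    then have "card ?U < card U" using fin by (rule card_Diff1_less[rotated])
    then obtain Z where Z: "Z \<subseteq> ?U" "2 * card ?P + card Z \<le> card (?X ?P) + weight (?U - Z)"
      using less.hyps[OF _ part] less.prems(2) by blast
    \<comment> \<open>No edge starts to cross, and \<open>e\<close> is lost together with its end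
      \<open>x\<close>.\<close>
    have "?X ?P \<subseteq> ?X P - {e}"
    proof
      fix f assume f: "f \<in> ?X ?P"
      have "\<Union>?P = ?U" using partition_onD1[OF part] by simp
      then have fU: "f \<in> edges G" "ends G f \<subseteq> ?U" using f unfolding cross_def by auto
      moreover have "\<not> ends G f \<subseteq> C" if "C \<in> P" for C
        using f that fU(2) unfolding cross_def by (cases "C = B") auto
      ultimately show "f \<in> ?X P - {e}" using split(4) P(1) unfolding cross_def by blast
    qed
    then have "card (?X ?P) \<le> card (?X P - {e})" using finX by (intro card_mono) auto
    then have "card (?X ?P) + 1 \<le> card (?X P)"
      using split(3) finX[of P] by (metis Suc_eq_plus1 Suc_le_mono card_Suc_Diff1)
    moreover have "card (insert x Z) = card Z + 1"
      using Z(1) fin by (subst card_insert_disjoint) (auto intro: finite_subset)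
    moreover have "U - insert x Z = ?U - Z" by blast
    ultimately have "2 * card P + card (insert x Z) \<le> card (?X P) + weight (U - insert x Z)"
      using Z(2) cardP by simp
    then show ?thesis using Z(1) U by (intro exI[of _ "insert x Z"]) auto
  next
    case drop
    let ?P = "P - {B}" and ?U = "U - B"
    have ne: "B \<noteq> {}" "B \<subseteq> U" using drop(1) P(1,3) by blast+
    have disj: "B \<inter> C = {}" if "C \<in> P" "C \<noteq> B" for C
      using disjointD[OF P(2) drop(1) that(1)] that(2) by blast
    have part: "partition_on ?U ?P"
    proof (rule partition_onI)
      show "\<Union>?P = ?U" using P(1) drop(1) disj by blast
      show "{} \<notin> ?P" using P(3) by blast
      show "disjnt C D" if "C \<in> ?P" "D \<in> ?P" "C \<noteq> D" for C D
        using that disjointD[OF P(2)] unfolding disjnt_def by blast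
    qed
    have "?U \<subset> U" using ne by blast
    then have "card ?U < card U" using fin by (rule psubset_card_mono[rotated])
    then obtain Z where Z: "Z \<subseteq> ?U" "2 * card ?P + card Z \<le> card (?X ?P) + weight (?U - Z)"
      using less.hyps[OF _ part] less.prems(2) by blast
    have cardP: "card P = card ?P + 1" using drop(1) finP by (metis Suc_eq_plus1 card_Suc_Diff1)
    have "?X ?P \<subseteq> ?X P"
    proof
      fix f assume f: "f \<in> ?X ?P"
      have "\<Union>?P = ?U" using partition_onD1[OF part] by simp
      then have fU: "f \<in> edges G" "ends G f \<subseteq> ?U" using f unfolding cross_def by auto
      moreover have "ends G f \<noteq> {}" using card_ends[OF fU(1)] by auto
      ultimately show "f \<in> ?X P" using f P(1) unfolding cross_def by blast
    qed
    then have "card (?X ?P) \<le> card (?X P)" using finX by (intro card_mono)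
    moreover have "weight (?U - Z) + 2 \<le> weight (?U - Z \<union> B)"
    proof (rule weight_Un(1))
      fix e assume e: "e \<in> edges G" "ends G e \<subseteq> ?U - Z \<union> B"
      show "ends G e \<subseteq> ?U - Z \<or> ends G e \<subseteq> B"
      proof (rule ccontr)
        assume no: "\<not> ?thesis"
        then have meet: "ends G e \<inter> B \<noteq> {}" using e(2) by blast
        then have "\<not> ends G e \<subseteq> C" if "C \<in> P" for C
          using no disj that by (cases "C = B") blast+
        moreover have "ends G e \<subseteq> \<Union>P" using e(2) ne P(1) by blast
        ultimately have "e \<in> ?X P" using e(1) by (simp add: cross_def)
        then show False using drop(2) meet by blast
      qed
    qed (use ne less.prems(2) in auto)
    moreover have "?U - Z \<union> B = U - Z" using ne Z(1) by blast
    ultimately have "2 * card P + card Z \<le> card (?X P) + weight (U - Z)"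
      using Z(2) cardP by simp
    then show ?thesis using Z(1) by blast
  next
    case singletons
    have P_eq: "P = (\<lambda>x. {x}) ` U"
    proof (intro equalityI subsetI)
      fix B assume "B \<in> P"
      then show "B \<in> (\<lambda>x. {x}) ` U" using singletons P(1) by blast
    next
      fix B assume "B \<in> (\<lambda>x. {x}) ` U"
      then obtain x where x: "x \<in> U" "B = {x}" by blast
      then obtain C where "C \<in> P" "x \<in> C" using P(1) by blast
      then show "B \<in> P" using singletons x(2) by (metis singletonD)
    qed
    have "card P = card U" unfolding P_eq by (rule card_image) simp
    moreover have "?X P = span U"
    proof (intro equalityI subsetI)
      fix e assume "e \<in> ?X P"
      then show "e \<in> span U" using P(1) by (simp add: cross_def induced_def)
    next
      fix e assume e: "e \<in> span U"
      have "\<not> ends G e \<subseteq> B" if "B \<in> P" for B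
        using e singletons[OF that] induced_singleton[OF subset_refl] unfolding induced_def by blast
      then show "e \<in> ?X P" using e P(1) by (simp add: cross_def induced_def)
    qed
    ultimately show ?thesis using vertex_weight[OF less.prems(2)] by simp
  qed
qed

end

section \<open>Bounding the degrees\<close>

context edge_system
begin

section \<open>Maximal tight sets and the existence of a tight edge set\<close>

definition blocks :: "'e set \<Rightarrow> 'v set \<Rightarrow> 'v set set" where
  "blocks H W = {B. B \<subseteq> W \<and> tight en H B \<and> (\<forall>C \<subseteq> W. tight en H C \<longrightarrow> B \<subseteq> C \<longrightarrow> C = B)}"

lemma tight_in_block:
  assumes "W \<subseteq> V" "X \<subseteq> W" "tight en H X"
  obtains B where "B \<in> blocks H W" "X \<subseteq> B"
proof -
  let ?T = "{C. C \<subseteq> W \<and> tight en H C}"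
  have "finite ?T"
    using finite_subset[OF assms(1) finite_V] by (auto intro: finite_subset[of _ "Pow W"])
  moreover have "X \<in> ?T" using assms by simp
  ultimately obtain B where B: "B \<in> ?T" "X \<subseteq> B" "\<forall>C\<in>?T. B \<subseteq> C \<longrightarrow> B = C"
    using finite_has_maximal2[of ?T X] by blast
  then have "B \<in> blocks H W" unfolding blocks_def by blast
  then show thesis using B(2) that by blast
qed

text \<open>Singletons are tight, so blocks cover \<open>W\<close>; two blocks that meet have a
  tight union, so by maximality they are equal.\<close>

lemma blocks_partition:
  assumes "H \<subseteq> E" "sparse en V H" "W \<subseteq> V"
  shows "partition_on W (blocks H W)"
proof (rule partition_onI)
  have "x \<in> \<Union>(blocks H W)" if "x \<in> W" for x
    using tight_in_block[OF assms(3) _ tight_singleton[OF assms(1)], of x] that by blast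
  then show "\<Union>(blocks H W) = W" unfolding blocks_def by blast
  show "{} \<notin> blocks H W" unfolding blocks_def tight_def by blast
  fix B C assume B: "B \<in> blocks H W" and C: "C \<in> blocks H W" and ne: "B \<noteq> C"
  show "disjnt B C"
  proof (rule ccontr)
    assume "\<not> disjnt B C"
    then have int: "B \<inter> C \<noteq> {}" by (simp add: disjnt_def)
    have sub: "B \<subseteq> W" "C \<subseteq> W" "tight en H B" "tight en H C" using B C unfolding blocks_def by blast+
    then have "tight en H (B \<union> C)" using tight_Int_Un(2)[OF assms(1,2)] int assms(3) by blast
    moreover have "B \<union> C \<subseteq> W" using sub by blast
    ultimately have "B \<union> C = B" "B \<union> C = C" using B C unfolding blocks_def by blast+
    then show False using ne by blast
  qed
qed

text \<open>Sum the equations of the tight parts; the remaining edges inside \<open>W\<close> are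
  the crossing ones.\<close>

lemma card_induced_partition:
  assumes H: "H \<subseteq> E" and W: "W \<subseteq> V" and P: "partition_on W P" and t: "\<And>B. B \<in> P \<Longrightarrow> tight en H B"
  shows "card (induced en H W) + 2 * card P = 2 * card W + card (cross en H P)"
proof -
  note D = partition_onD1[OF P] partition_onD2[OF P]
  have finW: "finite W" using W finite_V finite_subset by blast
  have fin: "finite H" "finite P" using H finite_sub finite_elements[OF finW P] by auto
  have finB: "finite B" if "B \<in> P" for B using that D(1) finW by (metis Union_upper finite_subset)
  have "(\<Sum>B\<in>P. card (induced en H B) + 2) = (\<Sum>B\<in>P. 2 * card B)"
    using t by (intro sum.cong) (auto simp: tight_def)
  then have "(\<Sum>B\<in>P. card (induced en H B)) + 2 * card P = 2 * (\<Sum>B\<in>P. card B)"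
    by (simp add: sum.distrib sum_distrib_left del: add_2_eq_Suc' add_2_eq_Suc)
  moreover have "card W = (\<Sum>B\<in>P. card B)"
    unfolding D(1) using D(2) finB by (intro card_Union_disjoint) auto
  moreover have "(\<Sum>B\<in>P. card (induced en H B)) = card (\<Union>B\<in>P. induced en H B)"
  proof (rule card_UN_disjoint[symmetric])
    show "\<forall>B\<in>P. \<forall>C\<in>P. B \<noteq> C \<longrightarrow> induced en H B \<inter> induced en H C = {}"
    proof (intro ballI impI)
      fix B C assume "B \<in> P" "C \<in> P" "B \<noteq> C"
      then have "B \<inter> C = {}" using disjointD[OF D(2)] by blast
      moreover have "induced en H B \<inter> induced en H C = induced en H (B \<inter> C)"
        by (auto simp: induced_def)
      moreover have "induced en H {} = {}" using induced_singleton[OF H] by (auto simp: induced_def)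
      ultimately show "induced en H B \<inter> induced en H C = {}" by simp
    qed
  qed (use fin in auto)
  moreover have "card (induced en H W) = card ((\<Union>B\<in>P. induced en H B) \<union> cross en H P)"
    unfolding D(1) by (rule arg_cong[where f = card]) (auto simp: induced_def cross_def)
  moreover have "\<dots> = card (\<Union>B\<in>P. induced en H B) + card (cross en H P)"
    using fin by (intro card_Un_disjoint) (auto simp: induced_def cross_def)
  ultimately show ?thesis by linarith
qed

text \<open>Apply \<open>room\<close> to the blocks of \<open>H\<close> outside \<open>S\<close>. An
  edge of \<open>E\<close> between blocks belongs to \<open>H\<close>, since otherwise
  \<open>closed\<close> would put it inside a tight set and so inside one block. Hence
  \<open>E\<close> has no more crossing edges than \<open>H\<close>, whose number
  \<open>card_induced_partition\<close> gives.\<close>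

lemma card_le_induced:
  assumes room: "\<forall>S \<subseteq> V. \<forall>P. partition_on (V - S) P \<longrightarrow> 2 * card P \<le> card (cross en E P) + card S + 2"
    and H: "H \<subseteq> E" "sparse en V H" and S: "S \<subseteq> V"
    and closed: "\<forall>e \<in> E - H. en e \<subseteq> V - S \<longrightarrow> (\<exists>X \<subseteq> V - S. tight en H X \<and> en e \<subseteq> X)"
  shows "2 * card (V - S) \<le> card (induced en H (V - S)) + card S + 2"
proof -
  have W: "V - S \<subseteq> V" by blast
  let ?P = "blocks H (V - S)"
  have P: "partition_on (V - S) ?P" by (rule blocks_partition[OF H W])
  have "cross en E ?P \<subseteq> cross en H ?P"
  proof
    fix e assume e: "e \<in> cross en E ?P"
    have "e \<in> H"
    proof (rule ccontr)
      assume "e \<notin> H"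
      moreover have eE: "e \<in> E" and "en e \<subseteq> \<Union>?P" using e unfolding cross_def by simp_all
      then have "en e \<subseteq> V - S" using partition_onD1[OF P] by simp
      ultimately have "\<exists>X \<subseteq> V - S. tight en H X \<and> en e \<subseteq> X" using closed eE by simp
      then obtain X where X: "X \<subseteq> V - S" "tight en H X" "en e \<subseteq> X" by (elim exE conjE)
      obtain B where "B \<in> ?P" "X \<subseteq> B" using tight_in_block[OF W X(1,2)] .
      then show False using e X(3) unfolding cross_def by blast
    qed
    then show "e \<in> cross en H ?P" using e unfolding cross_def by blast
  qed
  moreover have "finite (cross en H ?P)" using H(1) finite_sub unfolding cross_def by auto
  ultimately have "card (cross en E ?P) \<le> card (cross en H ?P)" by (rule card_mono[rotated])
  moreover have "card (induced en H (V - S)) + 2 * card ?P = 2 * card (V - S) + card (cross en H ?P)"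
    by (rule card_induced_partition[OF H(1) W P]) (auto simp: blocks_def)
  ultimately show ?thesis using room[rule_format, OF S P] by linarith
qed

text \<open>For empty \<open>S\<close>, \<open>room\<close> is the Nash-Williams-Tutte condition for
  two edge-disjoint spanning trees. In a maximal sparse set every missing edge is blocked by a tight
  set, so \<open>card_le_induced\<close> applies.\<close>

lemma ex_tight:
  assumes room: "\<forall>S \<subseteq> V. \<forall>P. partition_on (V - S) P \<longrightarrow> 2 * card P \<le> card (cross en E P) + card S + 2"
    and "V \<noteq> {}"
  shows "\<exists>H \<subseteq> E. sparse en V H \<and> tight en H V"
proof -
  let ?T = "{H. H \<subseteq> E \<and> sparse en V H}"
  have finT: "finite ?T"
    using finite_E by simp
  have "sparse en V {}"
    unfolding sparse_def
  proof (intro allI impI)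
    fix X assume "X \<subseteq> V" "X \<noteq> {}"
    then have "card X > 0" using finite_V by (meson card_gt_0_iff finite_subset)
    then show "card (induced en {} X) + 2 \<le> 2 * card X" by (simp add: induced_def)
  qed
  then have T0: "{} \<in> ?T" by simp
  from finite_has_maximal2[OF finT T0]
  obtain H where H: "H \<in> ?T" "\<forall>K\<in>?T. H \<subseteq> K \<longrightarrow> H = K" by (elim bexE conjE)
  then have HE: "H \<subseteq> E" and Hs: "sparse en V H" by blast+
  have "2 * card (V - {}) \<le> card (induced en H (V - {})) + card ({} :: 'v set) + 2"
  proof (rule card_le_induced[OF room HE Hs empty_subsetI], intro ballI impI)
    fix e assume e: "e \<in> E - H"
    show "\<exists>X \<subseteq> V - {}. tight en H X \<and> en e \<subseteq> X"
    proof (rule ccontr)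
      assume "\<not> ?thesis"
      then have "sparse en V (insert e H)"
        using sparse_insert[OF finite_sub[OF HE] Hs] by auto
      then show False using H(2) e HE by blast
    qed
  qed
  moreover have "card (induced en H V) + 2 \<le> 2 * card V" by (rule sparseD[OF Hs _ assms(2)]) simp
  ultimately have "tight en H V" using assms(2) unfolding tight_def by simp
  then show ?thesis using HE Hs by blast
qed

text \<open>The two \<open>max\<close> bounds say that no excess over \<open>5\<close> grows, and that \<open>w\<close> either gets room for one
  more edge or loses some of its excess.\<close>

definition improvable :: "'e set \<Rightarrow> 'v set \<Rightarrow> 'v \<Rightarrow> bool" where
  "improvable H S w \<longleftrightarrow> (\<exists>K B. K \<subseteq> E \<and> sparse en V K \<and> B \<subseteq> V - S \<and> w \<in> B \<and> tight en H B
     \<and> tight en K B \<and> K - induced en K B = H - induced en H B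
     \<and> (\<forall>v \<in> V. deg en K v \<le> max 5 (deg en H v)) \<and> deg en K w < max 5 (deg en H w))"

definition stuck :: "'e set \<Rightarrow> 'v set \<Rightarrow> 'v set" where
  "stuck H S = {w \<in> V. \<not> improvable H S w}"

text \<open>A larger \<open>S\<close> leaves no additional sets \<open>B\<close> in which to
  rearrange.\<close>

lemma stuck_mono: "S \<subseteq> T \<Longrightarrow> stuck H S \<subseteq> stuck H T"
proof -
  assume "S \<subseteq> T"
  then have "B \<subseteq> V - S" if "B \<subseteq> V - T" for B using that by blast
  then have "improvable H T w \<Longrightarrow> improvable H S w" for w
    unfolding improvable_def by (elim exE conjE) (intro exI conjI, assumption+)
  then show ?thesis unfolding stuck_def by blast
qed

text \<open>Two rearrangements inside disjoint tight sets containing the two ends of \<open>e\<close> make room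
  for \<open>e\<close>; exchanging \<open>e\<close> for an edge at \<open>w\<close> would then improve \<open>w\<close>.\<close>

lemma tight_avoiding_stuck:
  assumes H: "H \<subseteq> E" "sparse en V H" and ST: "S \<subseteq> T" "stuck H S \<subseteq> T"
    and e: "e \<in> E - H" "en e = {u, v}" and imp: "improvable H T u" "improvable H T v"
    and X: "X \<subseteq> V - S" "tight en H X" "en e \<subseteq> X"
    and apart: "\<not> (\<exists>X \<subseteq> V - T. tight en H X \<and> en e \<subseteq> X)"
  shows "\<exists>X \<subseteq> V - stuck H S. tight en H X \<and> en e \<subseteq> X"
proof -
  obtain Ku Bu where Ku: "Ku \<subseteq> E" "sparse en V Ku" "Bu \<subseteq> V - T" "u \<in> Bu" "tight en H Bu"
      "tight en Ku Bu" "Ku - induced en Ku Bu = H - induced en H Bu"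
      "\<forall>v \<in> V. deg en Ku v \<le> max 5 (deg en H v)" "deg en Ku u < max 5 (deg en H u)"
    using imp(1) unfolding improvable_def by blast
  obtain Kv Bv where Kv: "Kv \<subseteq> E" "sparse en V Kv" "Bv \<subseteq> V - T" "v \<in> Bv" "tight en H Bv"
      "tight en Kv Bv" "Kv - induced en Kv Bv = H - induced en H Bv"
      "\<forall>v \<in> V. deg en Kv v \<le> max 5 (deg en H v)" "deg en Kv v < max 5 (deg en H v)"
    using imp(2) unfolding improvable_def by blast
  have BV: "Bu \<subseteq> V" "Bv \<subseteq> V" "X \<subseteq> V" using Ku(3) Kv(3) X(1) by blast+
  have uv: "u \<in> X" "v \<in> X" using X(3) e(2) by auto
  \<comment> \<open>If the two sets met, their union would be a tight set around \<open>e\<close>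
    that avoids \<open>T\<close>.\<close>
  have disj: "Bu \<inter> Bv = {}"
  proof (rule ccontr)
    assume "Bu \<inter> Bv \<noteq> {}"
    then have "tight en H (Bu \<union> Bv)"
      by (rule tight_Int_Un(2)[OF H BV(1,2) Ku(5) Kv(5)])
    moreover have "Bu \<union> Bv \<subseteq> V - T" "en e \<subseteq> Bu \<union> Bv" using Ku(3,4) Kv(3,4) e(2) by auto
    ultimately show False using apart by blast
  qed
  have ne: "en h \<noteq> {}" if "h \<in> E" for h using card_en[OF that] by auto
  \<comment> \<open>Both rearrangements at once: \<open>L\<close> is \<open>Ku\<close> inside
    \<open>Bu\<close>, \<open>Kv\<close> inside \<open>Bv\<close>, and \<open>H\<close>
    elsewhere.\<close>
  define L where "L = (Ku - induced en Ku Bv) \<union> induced en Kv Bv"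
  have LE: "L \<subseteq> E" using Ku(1) Kv(1) unfolding L_def induced_def by blast
  have fin: "finite H" "finite Ku" "finite Kv" "finite L"
    using H(1) Ku(1) Kv(1) LE finite_sub by blast+
  have outside: "h \<in> Ku \<longleftrightarrow> h \<in> H" if "\<not> en h \<subseteq> Bu" for h
    using Ku(7) that unfolding induced_def by blast
  have outside': "h \<in> Kv \<longleftrightarrow> h \<in> H" if "\<not> en h \<subseteq> Bv" for h
    using Kv(7) that unfolding induced_def by blast
  have indBv: "induced en Ku Bv = induced en H Bv"
  proof -
    have "h \<in> Ku \<longleftrightarrow> h \<in> H" if "en h \<subseteq> Bv" for h
    proof (cases "h \<in> E")
      case True
      then have "\<not> en h \<subseteq> Bu" using that disj ne[of h] by blast
      then show ?thesis by (rule outside)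
    qed (use Ku(1) H(1) in blast)
    then show ?thesis unfolding induced_def by blast
  qed
  have KuBv: "tight en Ku Bv" using Kv(5) unfolding tight_def indBv .
  have L_sparse: "sparse en V L"
    unfolding L_def by (rule sparse_replace[OF Ku(1) Kv(1) Ku(2) Kv(2) BV(2) KuBv])
  have LBv: "induced en L Bv = induced en Kv Bv" unfolding L_def induced_def by blast
  have LBu: "induced en L Bu = induced en Ku Bu"
    using disj ne Ku(1) Kv(1) unfolding L_def induced_def by blast
  have tight_L: "tight en L Bu" "tight en L Bv"
    using Ku(6) Kv(6) unfolding tight_def LBu LBv by blast+
  \<comment> \<open>Around both sets, tightness for \<open>L\<close> and tightness for
    \<open>H\<close> are the same.\<close>
  have cardL: "card (induced en L Y) = card (induced en H Y)" if "Bu \<subseteq> Y" "Bv \<subseteq> Y" for Y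
  proof -
    have "card (induced en L Y) = card (induced en Ku Y)"
    proof (rule card_agree[OF fin(4,2) _ _ that(2)])
      show "L - induced en L Bv = Ku - induced en Ku Bv" unfolding L_def induced_def by blast
      show "card (induced en L Bv) = card (induced en Ku Bv)"
        using tight_L(2) KuBv unfolding tight_def by linarith
    qed
    also have "\<dots> = card (induced en H Y)"
    proof (rule card_agree[OF fin(2,1) Ku(7) _ that(1)])
      show "card (induced en Ku Bu) = card (induced en H Bu)"
        using Ku(5,6) unfolding tight_def by linarith
    qed
    finally show ?thesis .
  qed
  have degL: "deg en L x = (if x \<in> Bv then deg en Kv x else deg en Ku x)" for x
  proof -
    have "{h \<in> L. x \<in> en h} = {h \<in> Kv. x \<in> en h}" if x: "x \<in> Bv"
    proof -
      have "h \<in> L \<longleftrightarrow> h \<in> Kv" if "x \<in> en h" for h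
      proof (cases "en h \<subseteq> Bv")
        case True
        then show ?thesis unfolding L_def induced_def by blast
      next
        case False
        moreover have "\<not> en h \<subseteq> Bu" using that x disj by blast
        ultimately show ?thesis using outside[of h] outside'[of h] unfolding L_def induced_def by blast
      qed
      then show ?thesis by blast
    qed
    moreover have "{h \<in> L. x \<in> en h} = {h \<in> Ku. x \<in> en h}" if "x \<notin> Bv"
      using that unfolding L_def induced_def by blast
    ultimately show ?thesis unfolding deg_def by presburger
  qed
  have degL_le: "deg en L x \<le> max 5 (deg en H x)" if "x \<in> V" for x
    unfolding degL using that Ku(8) Kv(8) by simp
  have degL_less: "deg en L x < max 5 (deg en H x)" if "x \<in> en e" for x
    unfolding degL using that e(2) Ku(4,9) Kv(4,9) disj by auto
  have e_L: "e \<notin> L"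
  proof -
    have "\<not> en e \<subseteq> Bu" "\<not> en e \<subseteq> Bv" using Ku(3,5) Kv(3,5) apart by blast+
    then show ?thesis using outside[of e] e(1) unfolding L_def induced_def by blast
  qed
  \<comment> \<open>A set, tight for \<open>H\<close> and for \<open>L\<close>, within which the
    whole exchange takes place.\<close>
  define Y where "Y = X \<union> Bu \<union> Bv"
  have Y: "Y \<subseteq> V - S" "Y \<subseteq> V" "Bu \<subseteq> Y" "Bv \<subseteq> Y" "X \<subseteq> Y"
    using X(1) Ku(3) Kv(3) ST(1) unfolding Y_def by blast+
  have XBu: "tight en H (X \<union> Bu)"
    by (rule tight_Int_Un(2)[OF H BV(3,1) X(2) Ku(5)]) (use uv Ku(4) in blast)
  have HY: "tight en H Y"
    unfolding Y_def by (rule tight_Int_Un(2)[OF H _ BV(2) XBu Kv(5)]) (use BV uv Kv(4) in blast)+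
  then have LY: "tight en L Y" unfolding tight_def cardL[OF Y(3,4)] .
  \<comment> \<open>A minimal such \<open>Z\<close> consists of the vertices whose edges may be
    traded for \<open>e\<close>.\<close>
  let ?T = "{Z. Z \<subseteq> Y \<and> tight en L Z \<and> en e \<subseteq> Z}"
  have finT: "finite ?T" using finite_subset[OF Y(2) finite_V] by (auto intro: finite_subset[of _ "Pow Y"])
  have YT: "Y \<in> ?T" using LY X(3) Y(5) by blast
  from finite_has_minimal2[OF finT YT]
  obtain Z where Z: "Z \<in> ?T" "\<forall>Z'\<in>?T. Z' \<subseteq> Z \<longrightarrow> Z = Z'" by (elim bexE conjE)
  then have ZY: "Z \<subseteq> Y" and LZ: "tight en L Z" and eZ: "en e \<subseteq> Z" by blast+
  have ZV: "Z \<subseteq> V" using ZY Y(2) by blast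
  have uvZ: "u \<in> Z" "v \<in> Z" using eZ e(2) by auto
  show ?thesis
  proof (cases "Z \<inter> stuck H S = {}")
    \<comment> \<open>Enlarging \<open>Z\<close> by \<open>Bu\<close> and \<open>Bv\<close> makes it
      tight for \<open>H\<close>; both of these avoid \<open>T\<close>, hence also the stuck
      vertices.\<close>
    case True
    have ZBu: "tight en L (Z \<union> Bu)"
      by (rule tight_Int_Un(2)[OF LE L_sparse ZV BV(1) LZ tight_L(1)]) (use uvZ Ku(4) in blast)
    have "tight en L (Z \<union> Bu \<union> Bv)"
      by (rule tight_Int_Un(2)[OF LE L_sparse _ BV(2) ZBu tight_L(2)]) (use ZV BV uvZ Kv(4) in blast)+
    moreover have "card (induced en L (Z \<union> Bu \<union> Bv)) = card (induced en H (Z \<union> Bu \<union> Bv))"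
      by (rule cardL) blast+
    ultimately have "tight en H (Z \<union> Bu \<union> Bv)" unfolding tight_def by simp
    moreover have "Z \<union> Bu \<union> Bv \<subseteq> V - stuck H S" using True ZV Ku(3) Kv(3) ST(2) by blast
    ultimately show ?thesis using eZ by blast
  next
    \<comment> \<open>Trade an edge \<open>f\<close> at a stuck vertex \<open>w\<close> of
      \<open>Z\<close> for \<open>e\<close>. Since \<open>w\<close> is not an end of
      \<open>e\<close>, its degree drops, while both ends of \<open>e\<close> have room for it. So
      \<open>w\<close> would be improvable after all.\<close>
    case False
    then obtain w where w: "w \<in> Z" "w \<in> stuck H S" by blast
    have wB: "w \<notin> Bu" "w \<notin> Bv" using w(2) ST(2) Ku(3) Kv(3) by blast+
    then have we: "w \<notin> en e" using e(2) Ku(4) Kv(4) by auto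
    then have "u \<noteq> w" using e(2) by auto
    then obtain f where f: "f \<in> induced en L Z" "w \<in> en f"
      using tight_incident[OF LE L_sparse ZV LZ w(1) uvZ(1)] by blast
    then have fL: "f \<in> L" "en f \<subseteq> Y" using ZY unfolding induced_def by blast+
    define K where "K = insert e (L - {f})"
    have KE: "K \<subseteq> E" using LE e(1) unfolding K_def by blast
    have eE: "e \<in> E" using e(1) by blast
    have K_sparse: "sparse en V K"
      unfolding K_def using Z(2) ZY by (intro sparse_swap[OF LE L_sparse eE ZV LZ eZ _ f(1)]) blast
    have eY: "en e \<subseteq> Y" using eZ ZY by blast
    have "induced en K Y = insert e (induced en L Y - {f})"
      using eY unfolding K_def induced_def by blast
    moreover have "f \<in> induced en L Y" "e \<notin> induced en L Y - {f}"
      using fL e_L unfolding induced_def by blast+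
    ultimately have "card (induced en K Y) = card (induced en L Y)"
      using fin(4) by (metis card_Suc_Diff1 card_insert_disjoint finite_Diff finite_induced)
    then have KY: "tight en K Y" using LY unfolding tight_def by simp
    have "K - induced en K Y = L - induced en L Y"
      using eY fL unfolding K_def induced_def by blast
    also have "\<dots> = H - induced en H Y"
    proof -
      have "h \<in> L \<longleftrightarrow> h \<in> H" if "\<not> en h \<subseteq> Y" for h
      proof -
        have "\<not> en h \<subseteq> Bu" "\<not> en h \<subseteq> Bv" using that Y(3,4) by blast+
        then show ?thesis using outside[of h] unfolding L_def induced_def by blast
      qed
      then show ?thesis unfolding induced_def by blast
    qed
    finally have KH: "K - induced en K Y = H - induced en H Y" .
    have degK: "deg en K x \<le> max 5 (deg en H x)" if "x \<in> V" for x
    proof (cases "x \<in> en e")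
      case True
      have "{h \<in> K. x \<in> en h} \<subseteq> insert e {h \<in> L. x \<in> en h}" unfolding K_def by blast
      then have "deg en K x \<le> card (insert e {h \<in> L. x \<in> en h})"
        unfolding deg_def using fin(4) by (intro card_mono) auto
      also have "\<dots> \<le> Suc (deg en L x)"
        unfolding deg_def using fin(4) by (simp add: card_insert_if)
      finally show ?thesis using degL_less[OF True] by linarith
    next
      case False
      then have "{h \<in> K. x \<in> en h} \<subseteq> {h \<in> L. x \<in> en h}" unfolding K_def by blast
      then have "deg en K x \<le> deg en L x"
        unfolding deg_def using fin(4) by (intro card_mono) auto
      then show ?thesis using degL_le[OF that] by linarith
    qed
    have "{h \<in> K. w \<in> en h} = {h \<in> L. w \<in> en h} - {f}"
      using we unfolding K_def by auto
    moreover have "card ({h \<in> L. w \<in> en h} - {f}) < card {h \<in> L. w \<in> en h}"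
      by (rule card_Diff1_less) (use fin(4) f(2) fL(1) in simp_all)
    ultimately have "deg en K w < deg en L w"
      unfolding deg_def by simp
    moreover have "deg en L w \<le> max 5 (deg en H w)" using degL_le w(1) ZV by blast
    ultimately have "deg en K w < max 5 (deg en H w)" by linarith
    moreover have "w \<in> Y" using ZY w(1) by blast
    ultimately have "improvable H S w"
      unfolding improvable_def using KE K_sparse Y(1) HY KY KH degK
      by (intro exI[of _ K] exI[of _ Y] conjI ballI)
    then show ?thesis using w(2) unfolding stuck_def by blast
  qed
qed

text \<open>Iterate \<open>stuck H\<close> from the empty set; the iterates increase inside the
  finite \<open>V\<close> and stabilise at some \<open>S\<close>. If a missing edge outside
  \<open>S\<close> had no tight set around it avoiding \<open>S\<close>,
  \<open>tight_avoiding_stuck\<close> would still produce one avoiding each iterate in turn, at last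
  \<open>S\<close> itself.\<close>

lemma stuck_fixpoint:
  assumes H: "H \<subseteq> E" "sparse en V H" "tight en H V"
  obtains S where "S \<subseteq> V" "stuck H S = S" "\<forall>x \<in> S. deg en H x \<ge> 5"
    "\<forall>e \<in> E - H. en e \<subseteq> V - S \<longrightarrow> (\<exists>X \<subseteq> V - S. tight en H X \<and> en e \<subseteq> X)"
proof -
  define \<Phi> where "\<Phi> k = (stuck H ^^ k) {}" for k
  have next_eq: "\<Phi> (Suc k) = stuck H (\<Phi> k)" for k by (simp add: \<Phi>_def)
  have zero: "\<Phi> 0 = {}" by (simp add: \<Phi>_def)
  have \<Phi>V: "\<Phi> k \<subseteq> V" for k by (cases k) (auto simp: zero next_eq stuck_def)
  have inc: "\<Phi> k \<subseteq> \<Phi> (Suc k)" for k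
  proof (induction k)
    case (Suc k)
    show ?case unfolding next_eq[of "Suc k"] using stuck_mono[OF Suc.IH, of H] by (simp only: next_eq)
  qed (simp add: zero)
  have "\<exists>k. \<Phi> (Suc k) = \<Phi> k"
  proof (rule ccontr)
    assume no: "\<not> ?thesis"
    have "k \<le> card (\<Phi> k)" for k
    proof (induction k)
      case (Suc k)
      have "\<Phi> k \<subset> \<Phi> (Suc k)" using no inc by blast
      then have "card (\<Phi> k) < card (\<Phi> (Suc k))"
        using \<Phi>V finite_V by (meson finite_subset psubset_card_mono)
      then show ?case using Suc.IH by linarith
    qed simp
    then have "Suc (card V) \<le> card V"
      using \<Phi>V finite_V by (meson card_mono le_trans)
    then show False by simp
  qed
  then obtain k where fix_k: "stuck H (\<Phi> k) = \<Phi> k" unfolding next_eq by blast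
  have below: "\<Phi> j \<subseteq> \<Phi> k" for j
  proof (induction j)
    case (Suc j)
    then show ?case using stuck_mono[OF Suc.IH, of H] fix_k next_eq by simp
  qed (simp add: zero)
  have deg5: "deg en H x \<ge> 5" if "x \<in> \<Phi> j" for j x
    using that
  proof (induction j)
    case (Suc j)
    show ?case
    proof (rule ccontr)
      assume less: "\<not> ?thesis"
      then have "x \<notin> \<Phi> j" using Suc.IH by blast
      then have "{x} \<subseteq> V - \<Phi> j" using Suc.prems \<Phi>V by blast
      moreover have "deg en H x < max 5 (deg en H x)" using less by linarith
      \<comment> \<open>A degree below 5 already leaves room: \<open>H\<close> itself with the tight
        set \<open>{x}\<close> is the witness.\<close>
      ultimately have "improvable H (\<Phi> j) x"
        unfolding improvable_def using H(1,2) tight_singleton[OF H(1), of x]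
        by (intro exI[of _ H] exI[of _ "{x}"]) auto
      then show False
        using Suc.prems next_eq by (simp add: stuck_def)
    qed
  qed (simp add: zero)
  have closed: "\<exists>X \<subseteq> V - \<Phi> k. tight en H X \<and> en e \<subseteq> X" if e: "e \<in> E - H" "en e \<subseteq> V - \<Phi> k" for e
  proof (rule ccontr)
    assume apart: "\<not> ?thesis"
    have "card (en e) = 2" using card_en e(1) by blast
    then obtain u v where uv: "en e = {u, v}" unfolding card_2_iff by blast
    have "u \<notin> stuck H (\<Phi> k)" "v \<notin> stuck H (\<Phi> k)" "u \<in> V" "v \<in> V" using e(2) uv fix_k by auto
    then have imp: "improvable H (\<Phi> k) u" "improvable H (\<Phi> k) v" unfolding stuck_def by blast+
    have "\<exists>X \<subseteq> V - \<Phi> j. tight en H X \<and> en e \<subseteq> X" for j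
    proof (induction j)
      case 0
      \<comment> \<open>The chain of tight sets starts with \<open>V\<close>.\<close>
      then show ?case using H(3) e(2) zero by auto
    next
      case (Suc j)
      then obtain X where X: "X \<subseteq> V - \<Phi> j" "tight en H X" "en e \<subseteq> X" by blast
      have "stuck H (\<Phi> j) \<subseteq> \<Phi> k" using below[of "Suc j"] next_eq by simp
      from tight_avoiding_stuck[OF H(1,2) below this e(1) uv imp X apart]
      show ?case unfolding next_eq .
    qed
    then show False using apart by blast
  qed
  show thesis by (rule that[OF \<Phi>V fix_k]) (use deg5 closed in blast)+
qed

text \<open>At least total excess, a vertex of degree above 5 cannot be improved, so it lies in the
  set from \<open>stuck_fixpoint\<close>, and counting edges there gives a contradiction.\<close>

lemma ex_tight_bounded_degree:
  assumes room: "\<forall>S \<subseteq> V. \<forall>P. partition_on (V - S) P \<longrightarrow> 2 * card P \<le> card (cross en E P) + card S + 2"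
    and "V \<noteq> {}"
  shows "\<exists>H \<subseteq> E. sparse en V H \<and> tight en H V \<and> (\<forall>v \<in> V. deg en H v \<le> 5)"
proof -
  let ?Q = "\<lambda>H. H \<subseteq> E \<and> sparse en V H \<and> tight en H V"
  \<comment> \<open>Truncated subtraction, so that vertices of degree at most 5 count 0.\<close>
  let ?ex = "\<lambda>H. \<Sum>v\<in>V. deg en H v - 5"
  obtain H0 where "?Q H0" using ex_tight[OF room assms(2)] by blast
  then obtain H where Q: "?Q H" and least: "\<forall>K. ?Q K \<longrightarrow> ?ex H \<le> ?ex K"
    using ex_has_least_nat[of ?Q H0 ?ex] by blast
  then have H: "H \<subseteq> E" "sparse en V H" "tight en H V" by blast+
  have "deg en H w \<le> 5" if w: "w \<in> V" for w
  proof (rule ccontr)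
    assume "\<not> ?thesis"
    then have big: "deg en H w > 5" by simp
    obtain S where S: "S \<subseteq> V" "stuck H S = S" "\<forall>x \<in> S. deg en H x \<ge> 5"
      "\<forall>e \<in> E - H. en e \<subseteq> V - S \<longrightarrow> (\<exists>X \<subseteq> V - S. tight en H X \<and> en e \<subseteq> X)"
      using stuck_fixpoint[OF H] .
    have "\<not> improvable H S w"
    proof
      assume "improvable H S w"
      then obtain K B where K: "K \<subseteq> E" "sparse en V K" "B \<subseteq> V - S" "tight en H B" "tight en K B"
        "K - induced en K B = H - induced en H B"
        "\<forall>v \<in> V. deg en K v \<le> max 5 (deg en H v)" "deg en K w < max 5 (deg en H w)"
        unfolding improvable_def by blast
      have "B \<subseteq> V" using K(3) by blast
      \<comment> \<open>The change takes place inside a set tight for both, so the total number of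
        edges stays the same.\<close>
      have "card (induced en K V) = card (induced en H V)"
      proof (rule card_agree[OF _ _ K(6) _ \<open>B \<subseteq> V\<close>])
        show "card (induced en K B) = card (induced en H B)"
          using K(4,5) unfolding tight_def by linarith
      qed (use K(1) H(1) finite_sub in blast)+
      then have "tight en K V" using H(3) unfolding tight_def by simp
      then have "?ex H \<le> ?ex K" using least K(1,2) by blast
      moreover have "?ex K < ?ex H"
      proof (rule sum_strict_mono_ex1[OF finite_V])
        show "\<forall>v\<in>V. deg en K v - 5 \<le> deg en H v - 5" using K(7) by force
        show "\<exists>v\<in>V. deg en K v - 5 < deg en H v - 5"
          using w K(8) big by (intro bexI[of _ w]) auto
      qed
      ultimately show False by simp
    qed
    then have "w \<in> S" using S(2) w unfolding stuck_def by blast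
    then have "S \<noteq> {}" by blast
    have fin: "finite S" using S(1) finite_V finite_subset by blast
    \<comment> \<open>With s = |S|, this makes the edges of \<open>H\<close> outside
      \<open>S\<close> at least 2|V| - 3s - 2. Degrees of at least 5 on the nonempty
      \<open>S\<close> and sparsity inside it make them at most (2|V| - 2) + (2s - 2) - 5s, which is
      2 less.\<close>
    have "2 * card (V - S) \<le> card (induced en H (V - S)) + card S + 2"
      by (rule card_le_induced[OF room H(1,2) S(1,4)])
    moreover have "card (induced en H (V - S)) + (\<Sum>v\<in>S. deg en H v) = card H + card (induced en H S)"
      by (rule sum_deg[OF H(1) S(1)])
    moreover have "(\<Sum>v\<in>S. deg en H v) \<ge> (\<Sum>v\<in>S. 5)" using S(3) by (intro sum_mono) auto
    then have "(\<Sum>v\<in>S. deg en H v) \<ge> 5 * card S" by simp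
    moreover have "card (induced en H S) + 2 \<le> 2 * card S"
      by (rule sparseD[OF H(2) S(1) \<open>S \<noteq> {}\<close>])
    moreover have "card H + 2 = 2 * card V" using H(3) induced_V[OF H(1)] unfolding tight_def by simp
    moreover have "card V = card (V - S) + card S"
      using fin S(1) finite_V by (metis card_Diff_subset card_mono le_add_diff_inverse2)
    ultimately show False by linarith
  qed
  then show ?thesis using H by blast
qed

end

section \<open>The factor\<close>

lemma connects_mono:
  assumes "connects en V C" "C \<subseteq> F"
  shows "connects en V F"
proof -
  have "(adjacent en C)\<^sup>* \<subseteq> (adjacent en F)\<^sup>*"
    by (rule rtrancl_mono) (use assms(2) in \<open>auto simp: adjacent_def\<close>)
  then show ?thesis using assms(1) unfolding connects_def by blast
qed

lemma connects_connected_graph: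
  assumes "connects (ends G) (verts G) (edges G)" "verts G \<noteq> {}"
  shows "connected_graph G"
proof -
  have "adj_rel G = adjacent (ends G) (edges G)" by (simp add: adj_rel_def adjacent_def)
  then have "joined_rel G = verts G \<times> verts G"
    using assms(1) unfolding joined_rel_def connects_def by auto
  then have "components G = {verts G}"
    using assms(2) unfolding components_def quotient_def by auto
  then show ?thesis by (simp add: connected_graph_def num_components_def)
qed

lemma (in edge_system) connects_deg_pos:
  assumes "F \<subseteq> E" "connects en V F" "v \<in> V" "card V \<ge> 2"
  shows "deg en F v > 0"
proof -
  have "\<not> V \<subseteq> {v}" using assms(4) card_mono[of "{v}" V] by auto
  then obtain u where u: "u \<in> V" "u \<noteq> v" by blast
  then have "(v, u) \<in> (adjacent en F)\<^sup>*" using assms(2,3) unfolding connects_def by blast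
  then obtain w where "(v, w) \<in> adjacent en F" using u(2) by (metis converse_rtranclE)
  then obtain e where "e \<in> F" "v \<in> en e" unfolding adjacent_def by blast
  then have "{e \<in> F. v \<in> en e} \<noteq> {}" by blast
  then show ?thesis unfolding deg_def using finite_sub[OF assms(1)] by (simp add: card_gt_0_iff)
qed

text \<open>Delete \<open>Z\<close> from \<open>partition_weight\<close> along with
  \<open>S\<close>; the additional |Z| allowed by \<open>tough\<close> cancels against the |Z|
  gained there.\<close>

lemma (in multigraph) partition_bound:
  assumes tough: "\<forall>S \<subseteq> verts G. 2 * num_components (delete_verts G S)
      + 3 * num_isolated (delete_verts G S) \<le> card S + 2"
    and S: "S \<subseteq> verts G" and P: "partition_on (verts G - S) P"
  shows "2 * card P \<le> card (cross (ends G) (edges G) P) + card S + 2"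
proof -
  obtain Z where Z: "Z \<subseteq> verts G - S"
    "2 * card P + card Z \<le> card (cross (ends G) (edges G) P) + weight (verts G - S - Z)"
    using partition_weight[OF P] by blast
  have "verts G - (verts G - S - Z) = S \<union> Z" using S Z(1) by blast
  moreover have "S \<union> Z \<subseteq> verts G" using S Z(1) by blast
  ultimately have "weight (verts G - S - Z) \<le> card (S \<union> Z) + 2"
    using tough unfolding weight_def sub_def by simp
  moreover have "card (S \<union> Z) \<le> card S + card Z" by (rule card_Un_le)
  ultimately show ?thesis using Z(2) by linarith
qed

theorem theorem7p11:
  fixes G :: "('v, 'e) mgraph"
  assumes "multigraph G"
    and "card (verts G) \<ge> 3"
    and "\<And>S. S \<subseteq> verts G \<Longrightarrow>
      real (num_components (delete_verts G S))
        \<le> min (2 / 7 * real (card S))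
              (1 / 2 * real (card S) - 3 / 2 * real (num_isolated (delete_verts G S))) + 1"
  shows "\<exists>F. two_four_factor F G \<and> connected_graph F"
proof -
  interpret multigraph G by (rule assms(1))
  have ne: "verts G \<noteq> {}" using assms(2) by auto
  \<comment> \<open>The second term of the minimum, doubled and cleared of subtraction.\<close>
  have tough: "2 * num_components (delete_verts G S) + 3 * num_isolated (delete_verts G S) \<le> card S + 2"
    if "S \<subseteq> verts G" for S
    using assms(3)[OF that] by linarith
  obtain H where H: "H \<subseteq> edges G" "sparse (ends G) (verts G) H" "tight (ends G) H (verts G)"
    and bound: "\<forall>v \<in> verts G. deg (ends G) H v \<le> 5"
    using ex_tight_bounded_degree[OF _ ne] partition_bound tough by blast
  obtain C D where CD: "C \<subseteq> H" "D \<subseteq> H" "C \<inter> D = {}"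
    and conn: "connects (ends G) (verts G) C" "connects (ends G) (verts G) D"
    using tight_two_connected[OF sub_system[OF H(1)] H(2,3)] by blast
  obtain F where F: "C \<subseteq> F" "F \<subseteq> C \<union> D" and even: "\<forall>v. even (deg (ends G) F v)"
    using even_connected_subset[OF _ _ CD(3) conn] CD(1,2) H(1) by blast
  have FH: "F \<subseteq> H" using F(2) CD by blast
  then have FG: "F \<subseteq> edges G" using H(1) by blast
  have F_conn: "connects (ends G) (verts G) F" by (rule connects_mono[OF conn(1) F(1)])
  define F' where "F' = \<lparr>verts = verts G, edges = F, ends = ends G\<rparr>"
  have "degree F' v \<in> {2, 4}" if v: "v \<in> verts G" for v
  proof -
    have "deg (ends G) F v > 0" using connects_deg_pos[OF FG F_conn v] assms(2) by simp
    moreover have "deg (ends G) F v \<le> 5"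
      using deg_mono[OF finite_sub[OF H(1)] FH, of "ends G" v] bound v by fastforce
    moreover have "even (deg (ends G) F v)" using even by blast
    ultimately have "deg (ends G) F v \<in> {2, 4}" by (auto elim!: evenE)
    then show ?thesis by (simp add: F'_def degree_def deg_def)
  qed
  then have "two_four_factor F' G"
    using FG by (simp add: two_four_factor_def spanning_subgraph_def F'_def)
  moreover have "connected_graph F'"
    by (rule connects_connected_graph) (use F_conn ne in \<open>simp_all add: F'_def\<close>)
  ultimately show ?thesis by blast
qed

end
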